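(* The following hold for the constrained Riemann solver $\mathcal{R}_2^{\rm c}$. (a) If $Q_0<Q(u_{\rm c}(W_{\max}))$, then $\Omega_{\rm f}\cup\{u=(\rho,v)\in\Omega_{\rm c}: Q(u)\le Q_0,\ p^{-1}(W_{\max}-v)\,v\ge Q_0\}$ is an invariant domain for $\mathcal{R}_2^{\rm c}$. (b) If $Q(u_{\rm c}(W_{\max}))\le Q_0$, then $\Omega_{\rm f}\cup\{u_{\rm c}(W_{\max})\}$ is an invariant domain for $\mathcal{R}_2^{\rm c}$. (c) If $Q_0\ge Q(u_{\rm c}(W_{\rm c}))$, then $\Omega_{\rm c}$ is an invariant domain for $\mathcal{R}_2^{\rm c}$. (d) If $Q_0<Q(u_{\rm c}(W_{\rm c}))$, then $\Omega_{\rm c}\cup\{u\in\Omega_{\rm f}': Q(u)=Q_0\}$ is an invariant domain for $\mathcal{R}_2^{\rm c}$.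
   Context: **Data.** Fix $R_{\rm f}''>R_{\rm f}'>0$, $V\in C^2([0,R_{\rm f}''];[0,\infty))$ with $V(R_{\rm f}'')>0$, and $p\in C^2((0,+\infty);\mathbb{R})$ such that: for all $\rho\in[0,R_{\rm f}'']$, $V'(\rho)\le0$, $V(\rho)+\rho V'(\rho)>0$, $2V'(\rho)+\rho V''(\rho)\le0$; for all $\rho\in(0,+\infty)$, $p'(\rho)>0$, $2p'(\rho)+\rho p''(\rho)>0$; for all $\rho\in[R_{\rm f}',R_{\rm f}'']$, $V'(\rho)+p'(\rho)>0$, $V(\rho)<\rho p'(\rho)$. Put $V_{\max}=V(0)$, $V_{\min}=V(R_{\rm f}'')$, $W_{\max}=p(R_{\rm f}'')+V_{\min}$, $W_{\rm c}=p(R_{\rm f}')+V(R_{\rm f}')$, $R_{\max}=p^{-1}(W_{\max})$, $q_{\max}=R_{\rm f}''V_{\min}$. Fix $V_{\rm c}\in(0,V_{\min}]$ and $Q_0\in(0,q_{\max})$. **State space.** States are $u=(\rho,v)$ (density, speed). $\Omega_{\rm f}=\{u\in[0,R_{\rm f}'']\times[V_{\min},V_{\max}]: v=V(\rho)\}$, $\Omega_{\rm c}=\{u\in[R_{\rm f}',R_{\max}]\times[0,V_{\rm c}]: W_{\rm c}\le v+p(\rho)\le W_{\max}\}$, $\Omega=\Omega_{\rm f}\cup\Omega_{\rm c}$, $\Omega_{\rm f}'=\{u\in\Omega_{\rm f}:\rho<R_{\rm f}'\}$, $\Omega_{\rm f}''=\{u\in\Omega_{\rm f}:\rho\ge R_{\rm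 f}'\}$. $Q(u)=\rho v$; $W(u)=v+p(\rho)$ if $u\in\Omega_{\rm c}\cup\Omega_{\rm f}''$ and $W(u)=W_{\rm c}$ if $u\in\Omega_{\rm f}'$. Subscripts carry over: $u_*=(\rho_*,v_* )$, $q_*=Q(u_* )$, $w_*=W(u_* )$. For $w\in[W_{\rm c},W_{\max}]$: $u_{\rm c}(w)=(p^{-1}(w-V_{\rm c}),V_{\rm c})\in\Omega_{\rm c}$, and $u_{\rm f}(w)=(\rho_{\rm f}(w),v_{\rm f}(w))\in\Omega_{\rm f}''$ is defined by $v_{\rm f}(w)=V(\rho_{\rm f}(w))=w-p(\rho_{\rm f}(w))$. For $\rho_\ell\ne\rho_r$, $\sigma(u_\ell,u_r)=(q_r-q_\ell)/(\rho_r-\rho_\ell)$. **Riemann solvers.** For Riemann data $u_\ell$ ($x<0$), $u_r$ ($x>0$), a Riemann solver gives the self-similar profile, a function of $x$ (solution $(t,x)\mapsto\mathcal{R}[u_\ell,u_r](x/t)$); pointwise values are those of the right-continuous representative. $\mathcal{R}_{\rm LWR}$ is the standard (entropy) Riemann solver for $\rho_t+(\rho V(\rho))_x=0$, $v=V(\rho)$, in $\Omega_{\rm f}$ (concave flux). $\mathcal{R}_{\rm ARZ}$ is the standard (Lax) Riemann solver for the Aw–Rascle–Zhang system $\rho_t+(\rho v)_x=0$, $(\rho W)_t+(\rho vW)_x=0$ with $W=v+p(\rho)$ in $\Omega_{\rm c}$: $u_\ell$ is joined to $(p^{-1}(w_\ell-v_r),v_r)$ by a 1-wave (shock if $v_r<v_\ell$,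 rarefaction if $v_r>v_\ell$; $\lambda_1=v-\rho p'(\rho)$), which is joined to $u_r$ by a contact discontinuity of speed $v_r$. $\mathcal{R}_1$ on $\Omega^2$: $\mathcal{R}_1=\mathcal{R}_{\rm LWR}$ on $\Omega_{\rm f}^2$; $\mathcal{R}_1=\mathcal{R}_{\rm ARZ}$ on $\Omega_{\rm c}^2$; if $(u_\ell,u_r)\in\Omega_{\rm f}\times\Omega_{\rm c}$, with $u_m=(p^{-1}(w_\ell-v_r),v_r)$, $\mathcal{R}_1[u_\ell,u_r](x)=u_\ell$ for $x<\sigma(u_\ell,u_m)$ and $=\mathcal{R}_{\rm ARZ}[u_m,u_r](x)$ for $x>\sigma(u_\ell,u_m)$; if $(u_\ell,u_r)\in\Omega_{\rm c}\times\Omega_{\rm f}$, $\mathcal{R}_1[u_\ell,u_r](x)=\mathcal{R}_{\rm ARZ}[u_\ell,u_{\rm c}(w_\ell)](x)$ for $x<\sigma(u_{\rm c}(w_\ell),u_{\rm f}(w_\ell))$ and $=\mathcal{R}_{\rm LWR}[u_{\rm f}(w_\ell),u_r](x)$ for $x>\sigma(u_{\rm c}(w_\ell),u_{\rm f}(w_\ell))$. $\mathcal{R}_2$ on $\Omega^2$: if $(u_\ell,u_r)\in\Omega_{\rm f}\times\Omega_{\rm c}$, $\rho_\ell\ne0$ and $w_\ell<w_r$, then $\mathcal{R}_2[u_\ell,u_r](x)=u_\ell$ for $x<\sigma(u_\ell,u_r)$ and $=u_r$ for $x>\sigma(u_\ell,u_r)$; otherwise $\mathcal{R}_2[u_\ell,u_r]=\mathcal{R}_1[u_\ell,u_r]$.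 **Constrained solver $\mathcal{R}_2^{\rm c}$.** Let $\mathcal{C}_2=\{(u_\ell,u_r)\in\Omega^2: Q(\mathcal{R}_2[u_\ell,u_r](0^\pm))\le Q_0\}$, $\mathcal{N}_2=\{(u_\ell,u_r)\in\Omega^2: Q(\mathcal{R}_2[u_\ell,u_r](0^\pm))>Q_0\}$, and $\mathcal{N}^3=\{(u_\ell,u_r)\in\Omega_{\rm c}\times\Omega_{\rm f}: Q(u_{\rm f}(w_\ell))>Q_0\}\subseteq\mathcal{N}_2$. If $(u_\ell,u_r)\in\mathcal{C}_2$, $\mathcal{R}_2^{\rm c}[u_\ell,u_r]=\mathcal{R}_2[u_\ell,u_r]$. If $(u_\ell,u_r)\in\mathcal{N}^3$ and $Q_0>Q(u_{\rm c}(w_\ell))$, then $\mathcal{R}_2^{\rm c}[u_\ell,u_r](x)$ equals $\mathcal{R}_2[u_\ell,u_{\rm f}(w_\ell)](x)$ for $x<\sigma(u_{\rm f}(w_\ell),\hat u)$, $\hat u$ for $\sigma(u_{\rm f}(w_\ell),\hat u)<x<0$, and $\mathcal{R}_2[\check u,u_r](x)$ for $x>0$. For all other $(u_\ell,u_r)\in\mathcal{N}_2$, $\mathcal{R}_2^{\rm c}[u_\ell,u_r](x)$ equals $\mathcal{R}_2[u_\ell,\hat u](x)$ for $x<0$ and $\mathcal{R}_2[\check u,u_r](x)$ for $x>0$. In both cases $(\hat u,\check u)\in\Omega_{\rm c}\times\Omega$ is the unique pair with: (A) $\mathcal{R}_2[\check u,u_r](0^+)=\check u$, $Q(\hat u)=Q(\check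 u)=\min\{Q_0,Q(u_{\rm c}(W_{\max}))\}$, $W(\hat u)\ge w_\ell$; (B) any other pair $(\hat u',\check u')\in\Omega_{\rm c}\times\Omega$ satisfying (A) has $W(\hat u')>W(\hat u)$ or $W(\check u')<W(\check u)$. **Invariant domain.** $D\subseteq\Omega$ is an invariant domain for $\mathcal{R}_2^{\rm c}$ if $\mathcal{R}_2^{\rm c}[u_\ell,u_r](\mathbb{R})\subseteq D$ for all $u_\ell,u_r\in D$.
   Formalization: For exceptional data two choices of ǔ (one in Ω_c, one in Ω_f′) tie with W=W_c, so no pair satisfies (B) and the solver is undefined; there the state in Ω_c is chosen. If V_c=V_min, overlapping clauses of R_1 are applied in the listed order. *)

theory Defs
  imports "HOL-Analysis.Analysis"
begin

section \<open>Data of the phase transition model\<close>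

text \<open>A state is a pair (density, speed).\<close>

type_synonym state = "real \<times> real"

abbreviation rho :: "state \<Rightarrow> real" where "rho \<equiv> fst"
abbreviation vel :: "state \<Rightarrow> real" where "vel \<equiv> snd"

text \<open>The first and second derivatives of \<open>V\<close> and \<open>p\<close> are separate fields, tied to
  \<open>V\<close> and \<open>p\<close> by \<open>traffic_model\<close>. The domain \<open>[0, Rf'']\<close> of \<open>V\<close> has endpoints, where
  its derivatives are one-sided, so that \<open>deriv\<close> is not suitable.\<close>

record traffic_data =
  Rf' :: real
  Rf'' :: real
  V :: "real \<Rightarrow> real"
  V' :: "real \<Rightarrow> real"
  V'' :: "real \<Rightarrow> real"
  p :: "real \<Rightarrow> real"
  p' :: "real \<Rightarrow> real"
  p'' :: "real \<Rightarrow> real"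
  Vc :: real
  Q0 :: real

definition C2_with_derivs ::
  "real set \<Rightarrow> (real \<Rightarrow> real) \<Rightarrow> (real \<Rightarrow> real) \<Rightarrow> (real \<Rightarrow> real) \<Rightarrow> bool" where
  "C2_with_derivs S f f' f'' \<longleftrightarrow>
     (\<forall>x\<in>S. (f has_real_derivative f' x) (at x within S)) \<and>
     (\<forall>x\<in>S. (f' has_real_derivative f'' x) (at x within S)) \<and>
     continuous_on S f''"

definition Vmax :: "traffic_data \<Rightarrow> real" where "Vmax M = V M 0"
definition Vmin :: "traffic_data \<Rightarrow> real" where "Vmin M = V M (Rf'' M)"
definition Wmax :: "traffic_data \<Rightarrow> real" where "Wmax M = p M (Rf'' M) + Vmin M"
definition Wc :: "traffic_data \<Rightarrow> real" where "Wc M = p M (Rf' M) + V M (Rf' M)"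
definition qmax :: "traffic_data \<Rightarrow> real" where "qmax M = Rf'' M * Vmin M"

text \<open>\<open>p\<close> is injective on the positive half-line but may be bounded. In a \<open>traffic_model\<close>,
  \<open>pinv\<close> is only needed on \<open>[p (Rf'), Wmax]\<close>, which lies in the range of \<open>p\<close>:
  \<open>\<rho>\<^sup>2 p'(\<rho>)\<close> is increasing and \<open>Vmin < Rf'' p'(Rf'')\<close>.\<close>

definition pinv :: "traffic_data \<Rightarrow> real \<Rightarrow> real" where
  "pinv M w = the_inv_into {0<..} (p M) w"

definition Rmax :: "traffic_data \<Rightarrow> real" where "Rmax M = pinv M (Wmax M)"

definition traffic_model :: "traffic_data \<Rightarrow> bool" where
  "traffic_model M \<longleftrightarrow>
     0 < Rf' M \<and> Rf' M < Rf'' M \<and>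
     C2_with_derivs {0..Rf'' M} (V M) (V' M) (V'' M) \<and>
     (\<forall>r\<in>{0..Rf'' M}. 0 \<le> V M r) \<and> 0 < V M (Rf'' M) \<and>
     C2_with_derivs {0<..} (p M) (p' M) (p'' M) \<and>
     (\<forall>r\<in>{0..Rf'' M}. V' M r \<le> 0 \<and> V M r + r * V' M r > 0 \<and> 2 * V' M r + r * V'' M r \<le> 0) \<and>
     (\<forall>r>0. p' M r > 0 \<and> 2 * p' M r + r * p'' M r > 0) \<and>
     (\<forall>r\<in>{Rf' M..Rf'' M}. V' M r + p' M r > 0 \<and> V M r < r * p' M r) \<and>
     0 < Vc M \<and> Vc M \<le> Vmin M \<and>
     0 < Q0 M \<and> Q0 M < qmax M"


section \<open>State space\<close>

definition Omega_f :: "traffic_data \<Rightarrow> state set" where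
  "Omega_f M = {u. rho u \<in> {0..Rf'' M} \<and> vel u \<in> {Vmin M..Vmax M} \<and> vel u = V M (rho u)}"

definition Omega_c :: "traffic_data \<Rightarrow> state set" where
  "Omega_c M = {u. rho u \<in> {Rf' M..Rmax M} \<and> vel u \<in> {0..Vc M} \<and>
                   Wc M \<le> vel u + p M (rho u) \<and> vel u + p M (rho u) \<le> Wmax M}"

definition Omega :: "traffic_data \<Rightarrow> state set" where
  "Omega M = Omega_f M \<union> Omega_c M"

definition Omega_f' :: "traffic_data \<Rightarrow> state set" where
  "Omega_f' M = {u \<in> Omega_f M. rho u < Rf' M}"

definition Omega_f'' :: "traffic_data \<Rightarrow> state set" where
  "Omega_f'' M = {u \<in> Omega_f M. rho u \<ge> Rf' M}"

definition flow :: "state \<Rightarrow> real" where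
  "flow u = rho u * vel u"

definition mark :: "traffic_data \<Rightarrow> state \<Rightarrow> real" where
  "mark M u = (if u \<in> Omega_f' M then Wc M else vel u + p M (rho u))"

definition u_c :: "traffic_data \<Rightarrow> real \<Rightarrow> state" where
  "u_c M w = (pinv M (w - Vc M), Vc M)"

definition u_f :: "traffic_data \<Rightarrow> real \<Rightarrow> state" where
  "u_f M w = (THE u. u \<in> Omega_f'' M \<and> vel u = V M (rho u) \<and> vel u = w - p M (rho u))"

definition sigma :: "state \<Rightarrow> state \<Rightarrow> real" where
  "sigma ul ur = (flow ur - flow ul) / (rho ur - rho ul)"


section \<open>Riemann solvers\<close>

text \<open>Profiles are functions of \<open>x / t\<close>. They are right-continuous: at the speed of a
  discontinuity they take the value on its right.\<close>

text \<open>The flux \<open>\<rho> V(\<rho>)\<close> is concave, so that \<open>lwr_speed\<close> is nonincreasing, and it may be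
  affine on intervals. In the rarefaction fan the density is the right-continuous generalised
  inverse of \<open>lwr_speed\<close>, which is its inverse where the flux is strictly concave and jumps
  (a contact discontinuity) across an affine part.\<close>

definition lwr_speed :: "traffic_data \<Rightarrow> real \<Rightarrow> real" where
  "lwr_speed M r = V M r + r * V' M r"

definition R_LWR :: "traffic_data \<Rightarrow> state \<Rightarrow> state \<Rightarrow> real \<Rightarrow> state" where
  "R_LWR M ul ur x =
     (if rho ul < rho ur then (if x < sigma ul ur then ul else ur)
      else if x < lwr_speed M (rho ul) then ul
      else if x < lwr_speed M (rho ur) then
        (let r = Inf {r \<in> {rho ur..rho ul}. lwr_speed M r \<le> x} in (r, V M r))
      else ur)"

definition lambda1 :: "traffic_data \<Rightarrow> state \<Rightarrow> real" where
  "lambda1 M u = vel u - rho u * p' M (rho u)"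

text \<open>The 1-wave from \<open>ul\<close> to a state \<open>um\<close> with the same value of \<open>v + p(\<rho>)\<close>.\<close>

definition wave1 :: "traffic_data \<Rightarrow> state \<Rightarrow> state \<Rightarrow> real \<Rightarrow> state" where
  "wave1 M ul um x =
     (if vel um < vel ul then (if x < sigma ul um then ul else um)
      else if x < lambda1 M ul then ul
      else if x < lambda1 M um then
        (THE u. 0 < rho u \<and> vel u + p M (rho u) = mark M ul \<and>
                vel u \<in> {vel ul..vel um} \<and> lambda1 M u = x)
      else um)"

definition R_ARZ :: "traffic_data \<Rightarrow> state \<Rightarrow> state \<Rightarrow> real \<Rightarrow> state" where
  "R_ARZ M ul ur x =
     (let um = (pinv M (mark M ul - vel ur), vel ur)
      in if x < vel ur then wave1 M ul um x else ur)"

text \<open>\<open>Omega_f\<close> and \<open>Omega_c\<close> intersect when \<open>Vc = Vmin\<close>. Data covered by several clauses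
  are treated by the first one.\<close>

definition R1 :: "traffic_data \<Rightarrow> state \<Rightarrow> state \<Rightarrow> real \<Rightarrow> state" where
  "R1 M ul ur x =
     (if ul \<in> Omega_f M \<and> ur \<in> Omega_f M then R_LWR M ul ur x
      else if ul \<in> Omega_c M \<and> ur \<in> Omega_c M then R_ARZ M ul ur x
      else if ul \<in> Omega_f M \<and> ur \<in> Omega_c M then
        (let um = (pinv M (mark M ul - vel ur), vel ur)
         in if x < sigma ul um then ul else R_ARZ M um ur x)
      else
        (let uc = u_c M (mark M ul); uf = u_f M (mark M ul)
         in if x < sigma uc uf then R_ARZ M ul uc x else R_LWR M uf ur x))"

definition R2 :: "traffic_data \<Rightarrow> state \<Rightarrow> state \<Rightarrow> real \<Rightarrow> state" where
  "R2 M ul ur x =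
     (if ul \<in> Omega_f M \<and> ur \<in> Omega_c M \<and> rho ul \<noteq> 0 \<and> mark M ul < mark M ur
      then (if x < sigma ul ur then ul else ur)
      else R1 M ul ur x)"


section \<open>The constrained Riemann solver\<close>

definition trace_left :: "(real \<Rightarrow> state) \<Rightarrow> state" where
  "trace_left F = Lim (at_left 0) F"

definition trace_right :: "(real \<Rightarrow> state) \<Rightarrow> state" where
  "trace_right F = Lim (at_right 0) F"

text \<open>The two traces always have the same flow (Rankine-Hugoniot). Hence the complement of
  \<open>C2\<close> in \<open>Omega \<times> Omega\<close> consists of the data for which both flows exceed \<open>Q0\<close>.\<close>

definition C2 :: "traffic_data \<Rightarrow> (state \<times> state) set" where
  "C2 M = {(ul, ur) \<in> Omega M \<times> Omega M.
             flow (trace_left (R2 M ul ur)) \<le> Q0 M \<and> flow (trace_right (R2 M ul ur)) \<le> Q0 M}"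

definition N3 :: "traffic_data \<Rightarrow> (state \<times> state) set" where
  "N3 M = {(ul, ur) \<in> Omega_c M \<times> Omega_f M. flow (u_f M (mark M ul)) > Q0 M}"

definition admissible_pairs :: "traffic_data \<Rightarrow> state \<Rightarrow> state \<Rightarrow> (state \<times> state) set" where
  "admissible_pairs M ul ur =
     {(uhat, ucheck) \<in> Omega_c M \<times> Omega M.
        trace_right (R2 M ucheck ur) = ucheck \<and>
        flow uhat = min (Q0 M) (flow (u_c M (Wmax M))) \<and>
        flow ucheck = min (Q0 M) (flow (u_c M (Wmax M))) \<and>
        mark M uhat \<ge> mark M ul}"

text \<open>The solver uses the optimal admissible pair: every other admissible pair has a larger
  \<open>mark uhat\<close> or a smaller \<open>mark ucheck\<close>.\<close>

definition better_pair :: "traffic_data \<Rightarrow> state \<times> state \<Rightarrow> state \<times> state \<Rightarrow> bool" where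
  "better_pair M = (\<lambda>(uhat, ucheck) (uhat', ucheck').
     mark M uhat' > mark M uhat \<or> mark M ucheck' < mark M ucheck)"

text \<open>Optimality alone does not determine a pair for certain exceptional data: when \<open>ur\<close> is
  congested, \<open>mark ur > Wc\<close>, and the congested state with speed \<open>vel ur\<close> and the prescribed
  flow has mark exactly \<open>Wc\<close>, then both this state and a state of \<open>Omega_f'\<close> with the same
  flow can be admissible as \<open>ucheck\<close>, with the same maximal mark \<open>Wc\<close>. Such a tie is decided in
  favour of the congested state, which is the limit of the values of \<open>ucheck\<close> as \<open>vel ur\<close>
  increases to the exceptional value. By the lemma \<open>constrained_pair_eqI\<close> the pair is the
  optimal one in the sense of \<open>better_pair\<close> whenever that one exists.\<close>

definition tie_break :: "traffic_data \<Rightarrow> state \<times> state \<Rightarrow> state \<times> state \<Rightarrow> bool" where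
  "tie_break M = (\<lambda>(uhat, ucheck) (uhat', ucheck').
     mark M uhat' = mark M uhat \<and> mark M ucheck' = mark M ucheck \<and>
     ucheck \<in> Omega_c M \<and> ucheck' \<notin> Omega_c M)"

definition constrained_pair :: "traffic_data \<Rightarrow> state \<Rightarrow> state \<Rightarrow> state \<times> state" where
  "constrained_pair M ul ur =
     (THE s. s \<in> admissible_pairs M ul ur \<and>
        (\<forall>s' \<in> admissible_pairs M ul ur - {s}. better_pair M s s' \<or> tie_break M s s'))"

lemma constrained_pair_eqI:
  assumes "s \<in> admissible_pairs M ul ur"
    and "\<And>s'. s' \<in> admissible_pairs M ul ur \<Longrightarrow> s' \<noteq> s \<Longrightarrow> better_pair M s s'"
  shows "constrained_pair M ul ur = s"
  unfolding constrained_pair_def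
proof (rule the_equality)
  show "s \<in> admissible_pairs M ul ur \<and>
        (\<forall>s' \<in> admissible_pairs M ul ur - {s}. better_pair M s s' \<or> tie_break M s s')"
    using assms by auto
next
  fix t
  assume t: "t \<in> admissible_pairs M ul ur \<and>
        (\<forall>s' \<in> admissible_pairs M ul ur - {t}. better_pair M t s' \<or> tie_break M t s')"
  obtain a b where s: "s = (a, b)" by (cases s)
  obtain c d where tt: "t = (c, d)" by (cases t)
  have "(a, d) \<in> admissible_pairs M ul ur" "(c, b) \<in> admissible_pairs M ul ur"
    using t assms(1) unfolding s tt admissible_pairs_def by auto
  note mem = this
  have L: "better_pair M s s'" if "s' \<in> admissible_pairs M ul ur" "s' \<noteq> s" for s'
    using assms(2) that by blast
  have R: "better_pair M t s' \<or> tie_break M t s'"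
    if "s' \<in> admissible_pairs M ul ur" "s' \<noteq> t" for s'
    using t that by blast
  have "a = c"
  proof (rule ccontr)
    assume ne: "a \<noteq> c"
    then show False
      using L[of "(c, b)"] R[of "(a, d)"] mem
      unfolding s tt better_pair_def tie_break_def by simp
  qed
  moreover have "b = d"
  proof (rule ccontr)
    assume ne: "b \<noteq> d"
    then show False
      using L[of "(a, d)"] R[of "(c, b)"] mem
      unfolding s tt better_pair_def tie_break_def by auto
  qed
  ultimately show "t = s" by (simp add: s tt)
qed

definition R2c :: "traffic_data \<Rightarrow> state \<Rightarrow> state \<Rightarrow> real \<Rightarrow> state" where
  "R2c M ul ur x =
     (let uhat = fst (constrained_pair M ul ur);
          ucheck = snd (constrained_pair M ul ur);
          uf = u_f M (mark M ul)
      in if (ul, ur) \<in> C2 M then R2 M ul ur x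
         else if (ul, ur) \<in> N3 M \<and> Q0 M > flow (u_c M (mark M ul)) then
           (if x < sigma uf uhat then R2 M ul uf x
            else if x < 0 then uhat
            else R2 M ucheck ur x)
         else
           (if x < 0 then R2 M ul uhat x else R2 M ucheck ur x))"

definition invariant_domain :: "traffic_data \<Rightarrow> state set \<Rightarrow> bool" where
  "invariant_domain M D \<longleftrightarrow>
     D \<subseteq> Omega M \<and> (\<forall>ul\<in>D. \<forall>ur\<in>D. range (R2c M ul ur) \<subseteq> D)"

end

theory Submission
  imports Defs
begin

text \<open>Everything rests on the sign of the characteristic speed. On a Lax curve
  \<open>v + p(\<rho>) = w\<close> the speed \<open>\<lambda>\<^sub>1\<close> is the derivative of the flow with respect to the density. It
  is negative at the free-flow end \<open>u_f w\<close> of the curve and decreases with the density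
  (\<open>lambda1_neg\<close>). Hence the flow increases strictly with \<open>v\<close> along the curve, up to \<open>u_f w\<close>
  (\<open>flow_lax_less\<close>); at fixed \<open>v > 0\<close> it also increases with \<open>w\<close> (\<open>flow_lax_less_mark\<close>). All
  congested 1-waves, and all transitions from congested to free flow, therefore move backwards
  or stand still, contact discontinuities and free-flow waves move forward or stand still, and
  the state seen at \<open>x = 0\<close> can be read off for each type of data. Writing \<open>g\<^sub>w(v)\<close> for the flow of the state of speed \<open>v\<close>
  on the curve of mark \<open>w\<close>, it is \<open>g\<^sub>w(v)\<close> with \<open>w = mark ul\<close> and \<open>v = vel ur\<close> that passes at
  \<open>x = 0\<close> between congested states \<open>ul\<close> and \<open>ur\<close>, except for a single jump from a state common
  to both phases.

  The two components of the optimal pair can be found separately, since admissibility imposes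
  no joint condition (\<open>constrained_pair_eq\<close>). The left one has the smallest admissible mark.
  The right one is the free state of the prescribed flow if \<open>ur\<close> is free. If \<open>ur\<close> is congested,
  the prescribed flow is \<open>Q0\<close>, and the right state is the congested state of speed \<open>vel ur\<close>
  provided that its mark is at least \<open>Wc\<close>, and the free state otherwise. Its mark does not
  exceed \<open>Wmax\<close> because an active constraint forces \<open>g\<^sub>w(vel ur) > Q0\<close> for \<open>w = Wmax\<close>
  (\<open>capacity_exceeds_Q0\<close>, \<open>constrained_pair_cases\<close>).

  Invariance then reduces to the middle states of \<open>R2\<close>. In \<open>Omega_c\<close> they stay on curves with
  marks in \<open>[Wc, Wmax]\<close>, and the right state of the pair can leave \<open>Omega_c\<close> only if
  \<open>Q0 < g\<^sub>w(Vc)\<close> for \<open>w = Wc\<close>, which separates the two statements about \<open>Omega_c\<close>. For the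
  two sets that contain \<open>Omega_f\<close>: if \<open>Q0\<close> is below the flow of \<open>u_c Wmax\<close>, a middle state of
  flow at most \<open>Q0\<close> lies in the set, and one of larger flow would be seen at \<open>x = 0\<close>, so that the
  constraint is active; otherwise \<open>u_c Wmax\<close> itself is the only middle state that occurs.
  The phases overlap if \<open>Vc = Vmin\<close>, and all case distinctions below take the states of the
  overlap into account.\<close>

section \<open>Traces of piecewise constant profiles\<close>

lemma trace_rightI:
  assumes "0 < \<delta>" "\<And>x. 0 < x \<Longrightarrow> x < \<delta> \<Longrightarrow> F x = c"
  shows "trace_right F = c"
  unfolding trace_right_def
  by (intro tendsto_Lim tendsto_eventually)
     (auto simp: eventually_at_right_field assms intro!: exI[of _ \<delta>])

lemma trace_leftI:
  assumes "0 < \<delta>" "\<And>x. - \<delta> < x \<Longrightarrow> x < 0 \<Longrightarrow> F x = c"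
  shows "trace_left F = c"
  unfolding trace_left_def
  by (intro tendsto_Lim tendsto_eventually)
     (auto simp: eventually_at_left_field assms intro!: exI[of _ "- \<delta>"])

lemma sigma_sign:
  assumes "rho A < rho B"
  shows "0 < sigma A B \<longleftrightarrow> flow A < flow B" "sigma A B < 0 \<longleftrightarrow> flow B < flow A"
    "sigma A B = 0 \<longleftrightarrow> flow A = flow B"
  using assms by (auto simp: sigma_def zero_less_divide_iff divide_less_0_iff)

text \<open>A jump \<open>A\<close> to \<open>B\<close> followed by a jump \<open>B\<close> to \<open>C\<close> of speed \<open>c\<close>. By the Rankine-Hugoniot
  condition the first jump moves forward exactly if \<open>flow A < flow B\<close>, so that \<open>A\<close> is seen at
  \<open>x = 0\<close> only if its flow does not exceed that of \<open>B\<close>. The case \<open>A = B\<close> is a jump of size zero,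
  for which \<open>sigma A B = 0\<close>.\<close>

lemma double_jump_traces:
  assumes F: "\<And>x. F x = (if x < sigma A B then A else if x < c then B else C)"
    and dens: "rho A < rho B \<or> A = B" and c: "0 \<le> c" and C: "c = 0 \<Longrightarrow> flow C = flow B"
  shows "flow (trace_left F) \<le> flow B" "flow (trace_right F) \<le> flow B"
    "flow A < flow B \<Longrightarrow> trace_right F = A"
    "flow B \<le> flow A \<Longrightarrow> 0 < c \<Longrightarrow> trace_right F = B"
proof -
  have forward: "trace_left F = A" "trace_right F = A" if "flow A < flow B"
  proof -
    have "0 < sigma A B"
      using that dens sigma_sign(1)[of A B] by auto
    then show "trace_left F = A" "trace_right F = A"
      using F by (auto intro!: trace_leftI[of 1] trace_rightI[of "sigma A B"])
  qed
  have right: "trace_right F = (if 0 < c then B else C)" if "flow B \<le> flow A"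
  proof -
    have "sigma A B \<le> 0"
      using that dens sigma_sign(1)[of A B] by (cases "A = B") (auto simp: sigma_def)
    then show ?thesis
      using F c by (auto intro!: trace_rightI[of "if 0 < c then c else 1"])
  qed
  have left: "flow (trace_left F) = flow B" if "flow B \<le> flow A"
  proof (cases "flow B = flow A")
    case True
    then have "sigma A B = 0"
      by (simp add: sigma_def)
    then have "trace_left F = A"
      using F by (intro trace_leftI[of 1]) auto
    then show ?thesis using True by simp
  next
    case False
    then have "sigma A B < 0"
      using that dens sigma_sign(2)[of A B] by auto
    then have "trace_left F = B"
      using F c by (intro trace_leftI[of "- sigma A B"]) auto
    then show ?thesis by simp
  qed
  show "flow (trace_left F) \<le> flow B" "flow (trace_right F) \<le> flow B"
    using forward left right c C by (cases "flow A < flow B"; auto)+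
  show "flow A < flow B \<Longrightarrow> trace_right F = A"
    using forward(2) .
  show "flow B \<le> flow A \<Longrightarrow> 0 < c \<Longrightarrow> trace_right F = B"
    using right by simp
qed

section \<open>Monotonicity of the constitutive functions\<close>

locale phase_transition =
  fixes M :: traffic_data
  assumes model: "traffic_model M"
begin

lemma radii: "0 < Rf' M" "Rf' M < Rf'' M"
  and limits: "0 < Vc M" "Vc M \<le> Vmin M" "0 < Q0 M" "Q0 M < qmax M"
  using model by (auto simp: traffic_model_def)

lemma Vmin_pos: "0 < Vmin M"
  using limits by linarith

lemma V_deriv: "r \<in> {0..Rf'' M} \<Longrightarrow> (V M has_real_derivative V' M r) (at r within {0..Rf'' M})"
  using model by (auto simp: traffic_model_def C2_with_derivs_def)

lemma V_conditions:
  assumes "r \<in> {0..Rf'' M}"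
  shows "V' M r \<le> 0" "V M r + r * V' M r > 0"
  using model assms by (auto simp: traffic_model_def)

lemma p_deriv: "0 < r \<Longrightarrow> (p M has_real_derivative p' M r) (at r)"
  and p'_deriv: "0 < r \<Longrightarrow> (p' M has_real_derivative p'' M r) (at r)"
  using model by (auto simp: traffic_model_def C2_with_derivs_def at_within_open[of _ "{0<..}"])

lemma p_conditions:
  assumes "0 < r"
  shows "p' M r > 0" "2 * p' M r + r * p'' M r > 0"
  using model assms by (auto simp: traffic_model_def)

lemma free_branch_conditions:
  assumes "r \<in> {Rf' M..Rf'' M}"
  shows "V' M r + p' M r > 0" "V M r < r * p' M r"
  using model assms by (auto simp: traffic_model_def)

lemma p_strict_mono:
  assumes "0 < r" "r < s"
  shows "p M r < p M s"
proof (rule DERIV_pos_imp_increasing[OF assms(2)])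
  show "\<exists>y. (p M has_real_derivative y) (at x) \<and> 0 < y" if "r \<le> x" "x \<le> s" for x
    using that assms p_deriv[of x] p_conditions(1)[of x] by force
qed

lemma p_less_iff: "0 < r \<Longrightarrow> 0 < s \<Longrightarrow> p M r < p M s \<longleftrightarrow> r < s"
  using p_strict_mono[of r s] p_strict_mono[of s r] by (cases r s rule: linorder_cases) auto

lemma p_le_iff: "0 < r \<Longrightarrow> 0 < s \<Longrightarrow> p M r \<le> p M s \<longleftrightarrow> r \<le> s"
  using p_less_iff[of s r] by linarith

lemma p_continuous: "continuous_on {0<..} (p M)"
  using p_deriv by (meson DERIV_continuous_on greaterThan_iff has_field_derivative_at_within)

lemma V_continuous: "continuous_on {0..Rf'' M} (V M)"
  using V_deriv by (rule DERIV_continuous_on)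

lemma V_antimono:
  assumes "0 \<le> r" "r \<le> s" "s \<le> Rf'' M"
  shows "V M s \<le> V M r"
proof (rule DERIV_nonpos_imp_decreasing_open[OF assms(2)])
  show "\<exists>y. (V M has_real_derivative y) (at x) \<and> y \<le> 0" if "r < x" "x < s" for x
  proof -
    have "x \<in> interior {0..Rf'' M}" "x \<in> {0..Rf'' M}"
      using that assms by auto
    then show ?thesis
      using V_deriv[of x] V_conditions(1)[of x] by (metis at_within_interior)
  qed
  show "continuous_on {r..s} (V M)"
    using V_continuous by (rule continuous_on_subset) (use assms in auto)
qed

lemma free_flux_strict_mono:
  assumes "0 \<le> r" "r < s" "s \<le> Rf'' M"
  shows "r * V M r < s * V M s"
proof (rule DERIV_pos_imp_increasing_open[OF assms(2)])
  show "\<exists>y. ((\<lambda>x. x * V M x) has_real_derivative y) (at x) \<and> 0 < y" if "r < x" "x < s" for x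
  proof -
    have x: "x \<in> interior {0..Rf'' M}" "x \<in> {0..Rf'' M}"
      using that assms by auto
    then have "(V M has_real_derivative V' M x) (at x)"
      using V_deriv[of x] by (metis at_within_interior)
    then have "((\<lambda>x. x * V M x) has_real_derivative (V M x + x * V' M x)) (at x)"
      by (auto intro!: derivative_eq_intros)
    then show ?thesis
      using V_conditions(2)[OF x(2)] by blast
  qed
  show "continuous_on {r..s} (\<lambda>x. x * V M x)"
    by (intro continuous_intros continuous_on_subset[OF V_continuous]) (use assms in auto)
qed

lemma free_mark_strict_mono:
  assumes "Rf' M \<le> r" "r < s" "s \<le> Rf'' M"
  shows "V M r + p M r < V M s + p M s"
proof (rule DERIV_pos_imp_increasing_open[OF assms(2)])
  show "\<exists>y. ((\<lambda>x. V M x + p M x) has_real_derivative y) (at x) \<and> 0 < y" if "r < x" "x < s" for x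
  proof -
    have x: "x \<in> interior {0..Rf'' M}" "x \<in> {0..Rf'' M}" "0 < x" "x \<in> {Rf' M..Rf'' M}"
      using that assms radii by auto
    then have "(V M has_real_derivative V' M x) (at x)"
      using V_deriv[of x] by (metis at_within_interior)
    then have "((\<lambda>x. V M x + p M x) has_real_derivative (V' M x + p' M x)) (at x)"
      using p_deriv[OF x(3)] by (auto intro!: derivative_eq_intros)
    then show ?thesis
      using free_branch_conditions(1)[OF x(4)] by blast
  qed
  show "continuous_on {r..s} (\<lambda>x. V M x + p M x)"
    by (intro continuous_intros continuous_on_subset[OF V_continuous] continuous_on_subset[OF p_continuous])
       (use assms radii in auto)
qed

text \<open>Both expressions have the sign of \<open>2 p' + r p''\<close> as sign of their derivative. The first one is
  the derivative of \<open>r p(r)\<close>.\<close>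

lemma p_convexity:
  assumes "0 < r" "r < s"
  shows "p M r + r * p' M r < p M s + s * p' M s" "r\<^sup>2 * p' M r < s\<^sup>2 * p' M s"
proof -
  have d: "((\<lambda>x. p M x + x * p' M x) has_real_derivative 2 * p' M x + x * p'' M x) (at x)"
    "((\<lambda>x. x\<^sup>2 * p' M x) has_real_derivative x * (2 * p' M x + x * p'' M x)) (at x)"
    "0 < 2 * p' M x + x * p'' M x" "0 < x * (2 * p' M x + x * p'' M x)"
    if "r \<le> x" for x
  proof -
    have x: "0 < x" using that assms by simp
    show "((\<lambda>x. p M x + x * p' M x) has_real_derivative 2 * p' M x + x * p'' M x) (at x)"
      using DERIV_add[OF p_deriv[OF x] DERIV_mult[OF DERIV_ident p'_deriv[OF x]]]
      by (simp add: algebra_simps)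
    show "((\<lambda>x. x\<^sup>2 * p' M x) has_real_derivative x * (2 * p' M x + x * p'' M x)) (at x)"
      using DERIV_mult[OF DERIV_pow[of 2] p'_deriv[OF x]]
      by (simp add: algebra_simps power2_eq_square)
    show "0 < 2 * p' M x + x * p'' M x" "0 < x * (2 * p' M x + x * p'' M x)"
      using p_conditions(2)[OF x] x by simp_all
  qed
  show "p M r + r * p' M r < p M s + s * p' M s"
    using d(1,3) by (intro DERIV_pos_imp_increasing[OF assms(2)]) blast
  show "r\<^sup>2 * p' M r < s\<^sup>2 * p' M s"
    using d(2,4) by (intro DERIV_pos_imp_increasing[OF assms(2)]) blast
qed

text \<open>The pressure may be bounded, but \<open>r\<^sup>2 p'(r)\<close> increases, hence
  \<open>p(r) \<ge> p(Rf'') + c / Rf'' - c / r\<close> for \<open>r \<ge> Rf''\<close>, with \<open>c = Rf''\<^sup>2 p'(Rf'')\<close>. The limit of the right-hand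
  side exceeds \<open>Wmax\<close> because \<open>Vmin < Rf'' p'(Rf'')\<close>.\<close>

lemma pressure_reaches_Wmax: "\<exists>R\<ge>Rf'' M. Wmax M \<le> p M R"
proof -
  define b where "b = Rf'' M"
  define c where "c = b\<^sup>2 * p' M b"
  define \<epsilon> where "\<epsilon> = b * p' M b - Vmin M"
  have b: "0 < b" using radii by (simp add: b_def)
  have eps: "0 < \<epsilon>"
    using free_branch_conditions(2)[of b] radii by (simp add: \<epsilon>_def Vmin_def b_def)
  have c: "0 < c" using b p_conditions(1)[of b] by (simp add: c_def)
  \<comment> \<open>with this choice c / R is the gap between the limit and Wmax\<close>
  define R where "R = c / \<epsilon>"
  have "b * \<epsilon> \<le> c"
    using b Vmin_pos by (simp add: \<epsilon>_def c_def power2_eq_square algebra_simps)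
  then have bR: "b \<le> R" using eps by (simp add: R_def field_simps)
  have "p M b + c / b \<le> p M R + c / R"
  proof (rule DERIV_nonneg_imp_nondecreasing[OF bR])
    fix x assume x: "b \<le> x" "x \<le> R"
    then have "0 < x" using b by linarith
    have "c \<le> x\<^sup>2 * p' M x"
      using p_convexity(2)[of b x] x b by (cases "x = b") (auto simp: c_def)
    then have "0 \<le> p' M x - c / x\<^sup>2"
      using \<open>0 < x\<close> by (simp add: field_simps)
    moreover have "((\<lambda>x. p M x + c / x) has_real_derivative p' M x - c / x\<^sup>2) (at x)"
      using p_deriv[OF \<open>0 < x\<close>] \<open>0 < x\<close>
      by (auto intro!: derivative_eq_intros simp: power2_eq_square)
    ultimately show "\<exists>y. ((\<lambda>x. p M x + c / x) has_real_derivative y) (at x) \<and> 0 \<le> y"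
      by blast
  qed
  moreover have "c / b = b * p' M b" "c / R = \<epsilon>"
    using b c eps by (auto simp: c_def R_def power2_eq_square)
  ultimately have "Wmax M \<le> p M R"
    by (simp add: Wmax_def \<epsilon>_def b_def)
  then show ?thesis using bR b_def by blast
qed

lemma pinv_p:
  assumes "0 < r"
  shows "pinv M (p M r) = r"
proof -
  have "inj_on (p M) {0<..}"
  proof (rule inj_onI)
    fix x y assume "x \<in> {0<..}" "y \<in> {0<..}" "p M x = p M y"
    then show "x = y"
      using p_less_iff[of x y] p_less_iff[of y x] by simp
  qed
  then show ?thesis
    using assms by (auto simp: pinv_def the_inv_into_f_f)
qed

lemma pinv:
  assumes "p M (Rf' M) \<le> y" "y \<le> Wmax M"
  shows "p M (pinv M y) = y" "Rf' M \<le> pinv M y" "0 < pinv M y"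
proof -
  obtain R where R: "Rf'' M \<le> R" "Wmax M \<le> p M R"
    using pressure_reaches_Wmax by blast
  have "continuous_on {Rf' M..R} (p M)"
    by (rule continuous_on_subset[OF p_continuous]) (use radii in auto)
  then obtain r where r: "Rf' M \<le> r" "r \<le> R" "p M r = y"
    using IVT'[of "p M" "Rf' M" y R] assms R radii by auto
  then show "p M (pinv M y) = y" "Rf' M \<le> pinv M y" "0 < pinv M y"
    using pinv_p[of r] radii by auto
qed

lemma pinv_less:
  assumes "p M (Rf' M) \<le> x" "x < y" "y \<le> Wmax M"
  shows "pinv M x < pinv M y"
  using pinv[of x] pinv[of y] assms p_less_iff[of "pinv M x" "pinv M y"] by simp

section \<open>States along a Lax curve\<close>

abbreviation marks :: "real set" where "marks \<equiv> {Wc M..Wmax M}"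

lemma V_bounds:
  assumes "0 \<le> r" "r \<le> Rf'' M"
  shows "Vmin M \<le> V M r" "V M r \<le> Vmax M"
  using V_antimono[of r "Rf'' M"] V_antimono[of 0 r] assms by (auto simp: Vmin_def Vmax_def)

lemma Omega_fI: "0 \<le> r \<Longrightarrow> r \<le> Rf'' M \<Longrightarrow> (r, V M r) \<in> Omega_f M"
  using V_bounds by (auto simp: Omega_f_def)

lemma Omega_fD:
  assumes "u \<in> Omega_f M"
  shows "0 \<le> rho u" "rho u \<le> Rf'' M" "vel u = V M (rho u)" "Vmin M \<le> vel u" "Vc M \<le> vel u"
  using assms limits by (auto simp: Omega_f_def)

lemma Omega_f''D:
  assumes "u \<in> Omega_f'' M"
  shows "u \<in> Omega_f M" "Rf' M \<le> rho u" "mark M u = V M (rho u) + p M (rho u)"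
    "mark M u = vel u + p M (rho u)"
  using assms by (auto simp: Omega_f''_def Omega_f'_def mark_def Omega_f_def)

lemma Omega_f'D:
  assumes "u \<in> Omega_f' M"
  shows "u \<in> Omega_f M" "rho u < Rf' M" "mark M u = Wc M"
  using assms by (auto simp: Omega_f'_def mark_def)

lemma Omega_f_cases:
  assumes "u \<in> Omega_f M"
  obtains "u \<in> Omega_f' M" | "u \<in> Omega_f'' M"
  using assms by (force simp: Omega_f'_def Omega_f''_def)

lemma free_mark_mono:
  assumes "Rf' M \<le> r" "r \<le> s" "s \<le> Rf'' M"
  shows "V M r + p M r \<le> V M s + p M s"
  using free_mark_strict_mono[of r s] assms by (cases "r = s") auto

lemma mark_Omega_f:
  assumes "u \<in> Omega_f M"
  shows "mark M u \<in> marks"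
proof -
  have "Wc M \<le> V M r + p M r" "V M r + p M r \<le> Wmax M" if "Rf' M \<le> r" "r \<le> Rf'' M" for r
    using free_mark_mono[of "Rf' M" r] free_mark_mono[of r "Rf'' M"] that
    by (auto simp: Wc_def Wmax_def Vmin_def)
  note * = this
  show ?thesis
    using assms
  proof (cases rule: Omega_f_cases)
    case 1
    then show ?thesis
      using *[of "Rf'' M"] Omega_f'D(3)[OF 1] radii
        free_mark_mono[of "Rf' M" "Rf'' M"] by (simp add: Wc_def Wmax_def Vmin_def)
  next
    case 2
    then show ?thesis
      using *[of "rho u"] Omega_f''D[OF 2] Omega_fD[OF assms] by simp
  qed
qed

text \<open>The mark is constant on \<open>Omega_f'\<close> and increases strictly with the density on \<open>Omega_f''\<close>.\<close>

lemma rho_less_of_mark_less: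
  assumes "u \<in> Omega_f M" "u' \<in> Omega_f M" "mark M u < mark M u'"
  shows "rho u < rho u'"
  using assms(1)
proof (cases rule: Omega_f_cases)
  case 1
  then have "u' \<notin> Omega_f' M"
    using assms(3) Omega_f'D(3)[OF 1] Omega_f'D(3)[of u'] by auto
  then have "Rf' M \<le> rho u'"
    using assms(2) by (auto simp: Omega_f'_def)
  then show ?thesis
    using Omega_f'D(2)[OF 1] by simp
next
  case 2
  have "u' \<notin> Omega_f' M"
    using assms(3) mark_Omega_f[OF assms(1)] Omega_f'D(3)[of u'] by auto
  then have free': "u' \<in> Omega_f'' M"
    using assms(2) by (auto simp: Omega_f'_def Omega_f''_def)
  have "\<not> rho u' \<le> rho u"
    using assms(3) free_mark_mono[of "rho u'" "rho u"] Omega_f''D(2,3)[OF 2] Omega_f''D(2,3)[OF free']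
      Omega_fD(2)[OF assms(1)] by auto
  then show ?thesis by simp
qed

lemma free_state_unique:
  assumes "u \<in> Omega_f'' M" "u' \<in> Omega_f'' M" "mark M u = mark M u'"
  shows "u = u'"
proof -
  note u = Omega_f''D[OF assms(1)] Omega_fD[OF Omega_f''D(1)[OF assms(1)]]
  note u' = Omega_f''D[OF assms(2)] Omega_fD[OF Omega_f''D(1)[OF assms(2)]]
  have "rho u = rho u'"
    using free_mark_strict_mono[of "rho u" "rho u'"] free_mark_strict_mono[of "rho u'" "rho u"]
      assms(3) u(2,3,6) u'(2,3,6) by (cases "rho u" "rho u'" rule: linorder_cases) auto
  then show ?thesis
    using u(7) u'(7) by (simp add: prod_eq_iff)
qed

lemma u_f_mark:
  assumes "u \<in> Omega_f'' M"
  shows "u_f M (mark M u) = u"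
  unfolding u_f_def
proof (rule the_equality)
  fix z assume z: "z \<in> Omega_f'' M \<and> vel z = V M (rho z) \<and> vel z = mark M u - p M (rho z)"
  then have "mark M z = mark M u"
    using Omega_f''D(4)[of z] by simp
  then show "z = u"
    using free_state_unique z assms by blast
qed (use assms Omega_f''D[OF assms] Omega_fD[OF Omega_f''D(1)[OF assms]] in auto)

lemma u_f:
  assumes "w \<in> marks"
  shows "u_f M w \<in> Omega_f'' M" "mark M (u_f M w) = w"
proof -
  have "continuous_on {Rf' M..Rf'' M} (\<lambda>x. V M x + p M x)"
    by (intro continuous_intros continuous_on_subset[OF V_continuous]
        continuous_on_subset[OF p_continuous]) (use radii in auto)
  then obtain s where s: "Rf' M \<le> s" "s \<le> Rf'' M" "V M s + p M s = w"
    using IVT'[of "\<lambda>x. V M x + p M x" "Rf' M" w "Rf'' M"] assms radii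
    by (auto simp: Wc_def Wmax_def Vmin_def algebra_simps)
  then have "(s, V M s) \<in> Omega_f'' M"
    using Omega_fI[of s] radii by (auto simp: Omega_f''_def)
  moreover have "mark M (s, V M s) = w"
    using Omega_f''D(4)[OF calculation] s by simp
  ultimately show "u_f M w \<in> Omega_f'' M" "mark M (u_f M w) = w"
    using u_f_mark by metis+
qed

lemma vel_u_f:
  assumes "w \<in> marks"
  shows "Vc M \<le> vel (u_f M w)" "0 \<le> vel (u_f M w)" "u_f M w \<in> Omega_f M"
  using Omega_f''D(1)[OF u_f(1)[OF assms]] Omega_fD(5)[OF Omega_f''D(1)[OF u_f(1)[OF assms]]] limits
  by auto

text \<open>The state of speed \<open>v\<close> on the curve \<open>v + p(\<rho>) = w\<close>. On this curve the speed is a more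
  convenient parameter than the density, because a congested wave fixes either \<open>w\<close> or the
  speed.\<close>

definition lax :: "real \<Rightarrow> real \<Rightarrow> state" where
  "lax w v = (pinv M (w - v), v)"

lemma lax_simps [simp]: "rho (lax w v) = pinv M (w - v)" "vel (lax w v) = v"
  by (simp_all add: lax_def)

lemma flow_lax: "flow (lax w v) = pinv M (w - v) * v"
  by (simp add: flow_def)

lemma u_c_lax: "u_c M w = lax w (Vc M)"
  by (simp add: u_c_def lax_def)

lemma lax_density:
  assumes "w \<in> marks" "0 \<le> v" "v \<le> vel (u_f M w)"
  shows "p M (pinv M (w - v)) = w - v" "Rf' M \<le> pinv M (w - v)" "0 < pinv M (w - v)"
    "rho (u_f M w) \<le> pinv M (w - v)"
proof -
  define s where "s = rho (u_f M w)"
  have s: "Rf' M \<le> s" "w = vel (u_f M w) + p M s"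
    using u_f(2)[OF assms(1)] Omega_f''D(2,4)[OF u_f(1)[OF assms(1)]] by (auto simp: s_def)
  have "p M (Rf' M) \<le> p M s"
    using s(1) p_le_iff[of "Rf' M" s] radii by simp
  then have "p M (Rf' M) \<le> w - v" "w - v \<le> Wmax M"
    using s assms by auto
  from pinv[OF this] show "p M (pinv M (w - v)) = w - v" "Rf' M \<le> pinv M (w - v)" "0 < pinv M (w - v)"
    by auto
  moreover from this have "s \<le> pinv M (w - v)"
    using s assms radii p_le_iff[of s "pinv M (w - v)"] by auto
  ultimately show "rho (u_f M w) \<le> pinv M (w - v)"
    by (simp add: s_def)
qed

lemma lax_Vc_density:
  assumes "w \<in> marks" "0 \<le> v" "v \<le> Vc M"
  shows "p M (pinv M (w - v)) = w - v" "Rf' M \<le> pinv M (w - v)" "0 < pinv M (w - v)"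
  using lax_density[of w v] vel_u_f(1)[of w] assms by auto

text \<open>On a Lax curve \<open>\<lambda>\<^sub>1 = w - (p(\<rho>) + \<rho> p'(\<rho>))\<close> decreases with the density, and it is already
  negative at the free-flow end \<open>u_f w\<close>, where \<open>V(\<rho>) < \<rho> p'(\<rho>)\<close>. This is why every 1-wave
  travels backwards.\<close>

lemma lambda1_neg:
  assumes "w \<in> marks" "rho (u_f M w) \<le> r"
  shows "w - p M r - r * p' M r < 0"
proof -
  define s where "s = rho (u_f M w)"
  have s: "s \<in> {Rf' M..Rf'' M}" "w = V M s + p M s" "0 < s"
    using u_f(2)[OF assms(1)] Omega_f''D(2,3)[OF u_f(1)[OF assms(1)]]
      Omega_fD(2)[OF Omega_f''D(1)[OF u_f(1)[OF assms(1)]]] radii(1) by (auto simp: s_def)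
  have "p M s + s * p' M s \<le> p M r + r * p' M r"
    using p_convexity(1)[of s r] s(3) assms(2) by (cases "s = r") (auto simp: s_def)
  then show ?thesis
    using free_branch_conditions(2)[OF s(1)] s(2) by linarith
qed

lemma lambda1_lax_neg:
  assumes "w \<in> marks" "0 \<le> v" "v \<le> vel (u_f M w)"
  shows "lambda1 M (lax w v) < 0"
  using lambda1_neg[OF assms(1) lax_density(4)[OF assms]] lax_density(1)[OF assms]
  by (simp add: lambda1_def)

text \<open>The derivative of the flow \<open>\<rho> (w - p(\<rho>))\<close> along a Lax curve is \<open>\<lambda>\<^sub>1\<close>.\<close>

lemma lax_flow_decreasing_in_density:
  assumes "w \<in> marks" "rho (u_f M w) \<le> r" "r < r'"
  shows "r' * (w - p M r') < r * (w - p M r)"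
proof (rule DERIV_neg_imp_decreasing[OF assms(3)])
  fix x assume x: "r \<le> x" "x \<le> r'"
  have "0 < x"
    using Omega_f''D(2)[OF u_f(1)[OF assms(1)]] radii(1) x assms(2) by simp
  then have "((\<lambda>x. x * (w - p M x)) has_real_derivative w - p M x - x * p' M x) (at x)"
    using p_deriv[of x] by (auto intro!: derivative_eq_intros simp: algebra_simps)
  then show "\<exists>y. ((\<lambda>x. x * (w - p M x)) has_real_derivative y) (at x) \<and> y < 0"
    using lambda1_neg[OF assms(1), of x] assms(2) x by auto
qed

lemma lax_density_antimono:
  assumes "w \<in> marks" "0 \<le> v" "v < v'" "v' \<le> vel (u_f M w)"
  shows "pinv M (w - v') < pinv M (w - v)"
  using lax_density[of w v] lax_density[of w v'] assms
    p_less_iff[of "pinv M (w - v')" "pinv M (w - v)"] by simp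

lemma flow_lax_less:
  assumes "w \<in> marks" "0 \<le> v" "v < v'" "v' \<le> vel (u_f M w)"
  shows "flow (lax w v) < flow (lax w v')"
  using lax_flow_decreasing_in_density[OF assms(1) lax_density(4) lax_density_antimono[OF assms]]
    lax_density(1)[of w v] lax_density(1)[of w v'] assms
  by (simp add: flow_lax)

lemma flow_lax_less_iff:
  assumes "w \<in> marks" "0 \<le> v" "v \<le> vel (u_f M w)" "0 \<le> v'" "v' \<le> vel (u_f M w)"
  shows "flow (lax w v) < flow (lax w v') \<longleftrightarrow> v < v'"
  using flow_lax_less[of w v v'] flow_lax_less[of w v' v] assms
  by (cases v v' rule: linorder_cases) auto

lemma flow_lax_mono:
  assumes "w \<in> marks" "0 \<le> v" "v \<le> v'" "v' \<le> vel (u_f M w)"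
  shows "flow (lax w v) \<le> flow (lax w v')"
  using flow_lax_less[OF assms(1,2) _ assms(4)] assms(3) by (cases "v = v'") auto

lemma lax_u_f:
  assumes "w \<in> marks"
  shows "lax w (vel (u_f M w)) = u_f M w"
proof -
  have "0 < rho (u_f M w)" "w - vel (u_f M w) = p M (rho (u_f M w))"
    using u_f(2)[OF assms] Omega_f''D(2,4)[OF u_f(1)[OF assms]] radii(1) by auto
  then show ?thesis
    using pinv_p by (simp add: lax_def prod_eq_iff)
qed

lemma rho_lax_less_mark:
  assumes "w \<in> marks" "w' \<in> marks" "w < w'" "0 \<le> v" "v \<le> Vc M"
  shows "pinv M (w - v) < pinv M (w' - v)"
  using lax_Vc_density[of w v] lax_Vc_density[of w' v] assms
    p_less_iff[of "pinv M (w - v)" "pinv M (w' - v)"] by simp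

lemma flow_lax_less_mark:
  assumes "w \<in> marks" "w' \<in> marks" "w < w'" "0 < v" "v \<le> Vc M"
  shows "flow (lax w v) < flow (lax w' v)"
  using rho_lax_less_mark[OF assms(1-3)] assms(4,5) by (simp add: flow_lax)

lemma flow_lax_mono_mark:
  assumes "w \<in> marks" "w' \<in> marks" "w \<le> w'" "0 \<le> v" "v \<le> Vc M"
  shows "flow (lax w v) \<le> flow (lax w' v)"
  using rho_lax_less_mark[OF assms(1,2) _ assms(4,5)] assms(3,4)
  by (cases "w = w'") (auto simp: flow_lax intro!: mult_right_mono)

lemma Omega_c_not_f':
  assumes "u \<in> Omega_c M"
  shows "u \<notin> Omega_f' M"
  using assms by (auto simp: Omega_c_def Omega_f'_def)

lemma Omega_cD:
  assumes "u \<in> Omega_c M"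
  shows "u = lax (mark M u) (vel u)" "mark M u \<in> marks" "0 \<le> vel u" "vel u \<le> Vc M"
    "Rf' M \<le> rho u" "0 < rho u" "mark M u = vel u + p M (rho u)"
proof -
  show mark: "mark M u = vel u + p M (rho u)"
    using Omega_c_not_f'[OF assms] by (simp add: mark_def)
  show "mark M u \<in> marks" "0 \<le> vel u" "vel u \<le> Vc M" and r: "Rf' M \<le> rho u" "0 < rho u"
    using assms radii mark by (auto simp: Omega_c_def)
  show "u = lax (mark M u) (vel u)"
    using pinv_p[OF r(2)] mark by (simp add: lax_def)
qed

lemma lax_in_Omega_c:
  assumes "w \<in> marks" "0 \<le> v" "v \<le> Vc M"
  shows "lax w v \<in> Omega_c M" "mark M (lax w v) = w"
proof -
  note r = lax_Vc_density[OF assms]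
  have "p M (Rf' M) \<le> w - v"
    using r p_le_iff[of "Rf' M" "pinv M (w - v)"] radii(1) by simp
  then have "pinv M (w - v) \<le> Rmax M"
    using pinv_less[of "w - v" "Wmax M"] assms by (cases "w - v = Wmax M") (auto simp: Rmax_def)
  then show "lax w v \<in> Omega_c M"
    using r assms by (simp add: Omega_c_def)
  then show "mark M (lax w v) = w"
    using Omega_cD(7)[of "lax w v"] r(1) by simp
qed

lemma Omega_c_free:
  assumes "u \<in> Omega_c M" "u \<in> Omega_f M"
  shows "u \<in> Omega_f'' M" "vel u = Vc M" "Vmin M = Vc M"
  using Omega_c_not_f'[OF assms(1)] Omega_f_cases[OF assms(2)] Omega_cD[OF assms(1)]
    Omega_fD[OF assms(2)] limits by (blast, linarith+)

lemma mark_Omega: "u \<in> Omega M \<Longrightarrow> mark M u \<in> marks"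
  using mark_Omega_f[of u] Omega_cD(2)[of u] unfolding Omega_def by blast

lemma u_c_in_Omega_c: "w \<in> marks \<Longrightarrow> u_c M w \<in> Omega_c M" "w \<in> marks \<Longrightarrow> mark M (u_c M w) = w"
  using lax_in_Omega_c[of w "Vc M"] limits by (auto simp: u_c_lax)

lemma marks_ends: "Wc M \<in> marks" "Wmax M \<in> marks"
  using free_mark_mono[of "Rf' M" "Rf'' M"] radii by (auto simp: Wc_def Wmax_def Vmin_def)

lemma flow_less_iff_rho_less:
  assumes "u \<in> Omega_f M" "u' \<in> Omega_f M"
  shows "flow u < flow u' \<longleftrightarrow> rho u < rho u'"
  using free_flux_strict_mono[of "rho u" "rho u'"] free_flux_strict_mono[of "rho u'" "rho u"]
    Omega_fD[OF assms(1)] Omega_fD[OF assms(2)]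
  unfolding flow_def by (cases "rho u" "rho u'" rule: linorder_cases) auto

lemma free_state_eqI:
  assumes "u \<in> Omega_f M" "u' \<in> Omega_f M" "flow u = flow u'"
  shows "u = u'"
  using flow_less_iff_rho_less[OF assms(1,2)] flow_less_iff_rho_less[OF assms(2,1)] assms
    Omega_fD(3)[OF assms(1)] Omega_fD(3)[OF assms(2)] by (simp add: prod_eq_iff)

lemma flow_le_qmax:
  assumes "u \<in> Omega_f M"
  shows "flow u \<le> qmax M"
  using free_flux_strict_mono[of "rho u" "Rf'' M"] Omega_fD[OF assms]
  by (cases "rho u = Rf'' M") (auto simp: flow_def qmax_def Vmin_def)

lemma free_state_of_flow:
  assumes "0 \<le> q" "q \<le> qmax M"
  obtains u where "u \<in> Omega_f M" "flow u = q"
proof -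
  have "continuous_on {0..Rf'' M} (\<lambda>x. x * V M x)"
    by (intro continuous_intros V_continuous)
  then obtain r where "0 \<le> r" "r \<le> Rf'' M" "r * V M r = q"
    using IVT'[of "\<lambda>x. x * V M x" 0 q "Rf'' M"] assms radii by (auto simp: qmax_def Vmin_def)
  then show thesis
    using Omega_fI[of r] that[of "(r, V M r)"] by (simp add: flow_def)
qed

section \<open>Elementary waves\<close>

lemma lwr_states:
  assumes "ul \<in> Omega_f M" "ur \<in> Omega_f M"
  shows "R_LWR M ul ur x \<in> Omega_f M"
    "rho (R_LWR M ul ur x) \<in> {min (rho ul) (rho ur)..max (rho ul) (rho ur)}"
proof -
  have fan: "(Inf S, V M (Inf S)) \<in> Omega_f M \<and> Inf S \<in> {rho ur..rho ul}"
    if "S = {r \<in> {rho ur..rho ul}. lwr_speed M r \<le> x}" "rho ur \<le> rho ul" "lwr_speed M (rho ul) \<le> x" for S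
  proof -
    have S: "rho ul \<in> S" "S \<subseteq> {rho ur..rho ul}"
      using that by auto
    then have "rho ur \<le> Inf S"
      by (intro cInf_greatest) auto
    moreover have "Inf S \<le> rho ul"
      using S by (intro cInf_lower bdd_belowI[of _ "rho ur"]) auto
    ultimately show ?thesis
      using Omega_fI[of "Inf S"] Omega_fD(1)[OF assms(2)] Omega_fD(2)[OF assms(1)] by auto
  qed
  have "R_LWR M ul ur x \<in> Omega_f M \<and>
    rho (R_LWR M ul ur x) \<in> {min (rho ul) (rho ur)..max (rho ul) (rho ur)}"
    using assms fan by (simp add: R_LWR_def Let_def)
  then show "R_LWR M ul ur x \<in> Omega_f M"
    "rho (R_LWR M ul ur x) \<in> {min (rho ul) (rho ur)..max (rho ul) (rho ur)}" by auto
qed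

text \<open>Free-flow waves move forward: the flux increases with the density, so that shocks have positive
  speed, and \<open>lwr_speed\<close> is its derivative.\<close>

lemma lwr_ahead:
  assumes "ul \<in> Omega_f M" "ur \<in> Omega_f M"
  obtains \<delta> where "0 < \<delta>" "\<And>x. x < \<delta> \<Longrightarrow> R_LWR M ul ur x = ul"
proof (cases "rho ul < rho ur")
  case True
  then have "0 < sigma ul ur"
    using flow_less_iff_rho_less[OF assms] sigma_sign(1)[OF True] by simp
  then show thesis
    using that[of "sigma ul ur"] True by (simp add: R_LWR_def)
next
  case False
  have "0 < lwr_speed M (rho ul)"
    using V_conditions(2)[of "rho ul"] Omega_fD[OF assms(1)] by (simp add: lwr_speed_def)
  then show thesis
    using that[of "lwr_speed M (rho ul)"] False by (simp add: R_LWR_def)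
qed

lemma lambda1_eq: "lambda1 M u = (vel u + p M (rho u)) - (p M (rho u) + rho u * p' M (rho u))"
  by (simp add: lambda1_def)

text \<open>Inside the rarefaction fan the density solves \<open>p(r) + r p'(r) = w - x\<close>, whose left-hand
  side is continuous and strictly increasing.\<close>

lemma rarefaction_state:
  assumes ul: "ul \<in> Omega_c M" and v: "vel ul \<le> v" "v \<le> Vc M"
    and x: "lambda1 M ul \<le> x" "x < lambda1 M (lax (mark M ul) v)"
  shows "\<exists>v'\<in>{vel ul..v}. (THE u. 0 < rho u \<and> vel u + p M (rho u) = mark M ul \<and>
                vel u \<in> {vel ul..v} \<and> lambda1 M u = x) = lax (mark M ul) v'"
proof -
  define w where "w = mark M ul"
  define h where "h = (\<lambda>r. p M r + r * p' M r)"
  define r0 where "r0 = pinv M (w - v)"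
  note u = Omega_cD[OF ul, folded w_def]
  have r0: "p M r0 = w - v" "0 < r0"
    using lax_Vc_density[of w v] u v by (auto simp: r0_def)
  have le: "r0 \<le> rho ul"
    using p_le_iff[of r0 "rho ul"] r0 u v by simp
  have "continuous_on {r0..rho ul} h"
  proof -
    have "continuous_on {r0..rho ul} (p' M)"
      using p'_deriv r0(2)
      by (meson DERIV_continuous_on atLeastAtMost_iff has_field_derivative_at_within less_le_trans)
    then show ?thesis
      unfolding h_def using r0(2)
      by (intro continuous_intros continuous_on_subset[OF p_continuous]) auto
  qed
  moreover have "h r0 \<le> w - x" "w - x \<le> h (rho ul)"
    using x r0(1) u(7) unfolding h_def w_def[symmetric] lambda1_eq lax_simps r0_def by linarith+
  ultimately obtain r where r: "r0 \<le> r" "r \<le> rho ul" "h r = w - x"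
    using IVT'[of h r0 "w - x" "rho ul"] le by auto
  define v' where "v' = w - p M r"
  have "0 < r" using r r0 by simp
  have v': "vel ul \<le> v'" "v' \<le> v"
    using p_le_iff[of r0 r] p_le_iff[of r "rho ul"] r r0 u \<open>0 < r\<close> by (auto simp: v'_def)
  have lax_r: "lax w v' = (r, v')"
    using pinv_p[OF \<open>0 < r\<close>] by (simp add: lax_def v'_def)
  have "(THE u. 0 < rho u \<and> vel u + p M (rho u) = w \<and> vel u \<in> {vel ul..v} \<and> lambda1 M u = x)
      = lax w v'"
  proof (rule the_equality)
    have "lambda1 M (r, v') = x"
      using r(3) by (simp add: lambda1_eq h_def v'_def)
    then show "0 < rho (lax w v') \<and> vel (lax w v') + p M (rho (lax w v')) = w \<and>
        vel (lax w v') \<in> {vel ul..v} \<and> lambda1 M (lax w v') = x"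
      unfolding lax_r using \<open>0 < r\<close> v' by (simp add: v'_def)
  next
    \<comment> \<open>the speed of the characteristic determines the density on the curve\<close>
    fix z assume z: "0 < rho z \<and> vel z + p M (rho z) = w \<and> vel z \<in> {vel ul..v} \<and> lambda1 M z = x"
    then have "h (rho z) = h r"
      using r(3) lambda1_eq[of z] by (simp add: h_def)
    then have "rho z = r"
      using p_convexity(1)[of "rho z" r] p_convexity(1)[of r "rho z"] z \<open>0 < r\<close>
      unfolding h_def by (cases "rho z" r rule: linorder_cases) auto
    then show "z = lax w v'"
      unfolding lax_r using z by (auto simp: prod_eq_iff v'_def)
  qed
  then show ?thesis
    using v' unfolding w_def by auto
qed

lemma wave1_states:
  assumes "ul \<in> Omega_c M" "0 \<le> v" "v \<le> Vc M"
  shows "wave1 M ul (lax (mark M ul) v) x = ul \<or>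
    wave1 M ul (lax (mark M ul) v) x = lax (mark M ul) v \<or>
    (\<exists>v'\<in>{vel ul..v}. wave1 M ul (lax (mark M ul) v) x = lax (mark M ul) v')"
  using rarefaction_state[OF assms(1) _ assms(3), of x] unfolding wave1_def lax_simps(2)
  by (smt (verit))

text \<open>Both kinds of 1-wave have moved past \<open>x = 0\<close>: the flow falls and the density grows across a
  shock, and a fan ends at \<open>lambda1\<close> of its right state, which is negative.\<close>

lemma wave1_ahead:
  assumes "ul \<in> Omega_c M" "0 \<le> v" "v \<le> Vc M"
  obtains \<delta> where "\<delta> < 0" "\<And>x. \<delta> \<le> x \<Longrightarrow> wave1 M ul (lax (mark M ul) v) x = lax (mark M ul) v"
proof -
  define w where "w = mark M ul"
  define um where "um = lax w v"
  note u = Omega_cD[OF assms(1), folded w_def]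
  have vf: "Vc M \<le> vel (u_f M w)"
    using vel_u_f(1)[OF u(2)] .
  have backward: "lambda1 M um < 0"
    using lambda1_lax_neg[OF u(2), of v] assms vf by (simp add: um_def)
  show thesis
  proof (cases "v < vel ul")
    case True
    have "flow um < flow ul" "rho ul < rho um"
      using flow_lax_less[OF u(2) assms(2) True] lax_density_antimono[OF u(2) assms(2) True] u(1,4) vf
      by (metis order_trans um_def, metis order_trans um_def lax_simps(1))
    then have "sigma ul um < 0"
      using sigma_sign(2)[of ul um] by simp
    then show thesis
      using that[of "sigma ul um"] True by (simp add: wave1_def um_def w_def)
  next
    case False
    have "lambda1 M ul \<le> lambda1 M um"
    proof (cases "v = vel ul")
      case True
      then show ?thesis using u(1) by (simp add: um_def)
    next
      case neq: False
      have "rho um < rho ul"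
        using lax_density_antimono[OF u(2) u(3), of v] neq False vf assms(3) u(1)
        by (metis linorder_cases order_trans um_def lax_simps(1))
      moreover have "0 < rho um" "vel um + p M (rho um) = w"
        using lax_Vc_density[OF u(2) assms(2,3)] by (auto simp: um_def)
      ultimately show ?thesis
        using p_convexity(1)[of "rho um" "rho ul"] u(7) by (simp add: lambda1_eq)
    qed
    then show thesis
      using that[OF backward] False by (simp add: wave1_def um_def w_def)
  qed
qed

lemma R_ARZ_eq:
  "R_ARZ M ul ur x =
    (if x < vel ur then wave1 M ul (lax (mark M ul) (vel ur)) x else ur)"
  by (simp add: R_ARZ_def lax_def)

lemma R_ARZ_contact:
  assumes "w \<in> marks" "ur \<in> Omega_c M"
  shows "R_ARZ M (lax w (vel ur)) ur x = (if x < vel ur then lax w (vel ur) else ur)"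
  using lax_in_Omega_c(2)[OF assms(1), of "vel ur"] Omega_cD(3,4)[OF assms(2)]
  by (simp add: R_ARZ_eq wave1_def)

section \<open>The unconstrained solver by type of data\<close>

text \<open>If \<open>ur\<close> also belongs to \<open>Omega_c\<close>, \<open>R2\<close> may prescribe a single jump. A larger mark means a larger
  density in free flow, so that this jump is the shock of the solver for free flow.\<close>

lemma R2_free:
  assumes "ul \<in> Omega_f M" "ur \<in> Omega_f M"
  shows "R2 M ul ur x = R_LWR M ul ur x"
  using assms rho_less_of_mark_less[OF assms] by (simp add: R2_def R1_def R_LWR_def)

lemma R2_congested:
  assumes "ul \<in> Omega_c M" "ul \<notin> Omega_f M" "ur \<in> Omega_c M"
  shows "R2 M ul ur x = R_ARZ M ul ur x"
  using assms by (simp add: R2_def R1_def)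

lemma R2_congested_free:
  assumes "ul \<in> Omega_c M" "ul \<notin> Omega_f M" "ur \<in> Omega_f M" "ur \<notin> Omega_c M"
  shows "R2 M ul ur x =
    (if x < sigma (u_c M (mark M ul)) (u_f M (mark M ul)) then R_ARZ M ul (u_c M (mark M ul)) x
     else R_LWR M (u_f M (mark M ul)) ur x)"
  using assms by (simp add: R2_def R1_def Let_def)

lemma R2_shock:
  assumes "ul \<in> Omega_f M" "ur \<in> Omega_c M" "rho ul \<noteq> 0" "mark M ul < mark M ur"
  shows "R2 M ul ur x = (if x < sigma ul ur then ul else ur)"
  using assms by (simp add: R2_def)

lemma middle_state:
  assumes "ul \<in> Omega M" "ur \<in> Omega_c M"
  shows "lax (mark M ul) (vel ur) \<in> Omega_c M" "mark M (lax (mark M ul) (vel ur)) = mark M ul"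
  using lax_in_Omega_c[OF mark_Omega[OF assms(1)]] Omega_cD(3,4)[OF assms(2)] by auto

lemma middle_state_denser:
  assumes "ul \<in> Omega_f M" "0 \<le> v" "v \<le> Vc M"
  shows "rho ul < rho (lax (mark M ul) v) \<or> ul = lax (mark M ul) v"
  using assms(1)
proof (cases rule: Omega_f_cases)
  case 1
  then show ?thesis
    using Omega_f'D(2)[OF 1] lax_Vc_density(2)[OF mark_Omega_f[OF assms(1)] assms(2,3)] by simp
next
  case 2
  have ul: "ul = lax (mark M ul) (vel ul)"
    using lax_u_f[OF mark_Omega_f[OF assms(1)]] u_f_mark[OF 2] by simp
  show ?thesis
  proof (cases "v = vel ul")
    case True
    then show ?thesis using ul by simp
  next
    case False
    then have "v < vel ul"
      using assms(3) Omega_fD(5)[OF assms(1)] by simp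
    then have "pinv M (mark M ul - vel ul) < pinv M (mark M ul - v)"
      using lax_density_antimono[OF mark_Omega_f[OF assms(1)] assms(2), of "vel ul"] u_f_mark[OF 2]
      by simp
    then show ?thesis using ul by (metis lax_simps(1))
  qed
qed

text \<open>Also a state \<open>ul\<close> of \<open>Omega_f \<inter> Omega_c\<close> fits this description: the 1-wave of the
  congested solver is then a shock, or it is trivial because \<open>vel ur = vel ul\<close>.\<close>

lemma R2_free_congested:
  assumes "ul \<in> Omega_f M" "ur \<in> Omega_c M" "ur \<notin> Omega_f M"
    and "rho ul = 0 \<or> mark M ur \<le> mark M ul"
  shows "R2 M ul ur x =
    (if x < sigma ul (lax (mark M ul) (vel ur)) then ul
     else if x < vel ur then lax (mark M ul) (vel ur) else ur)"
proof -
  define um where "um = lax (mark M ul) (vel ur)"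
  have w: "mark M ul \<in> marks" using mark_Omega_f[OF assms(1)] .
  note ur = Omega_cD[OF assms(2)]
  show ?thesis
  proof (cases "ul \<in> Omega_c M")
    case True
    note ul = Omega_cD[OF True]
    have v: "vel ul = Vc M" using Omega_c_free(2)[OF True assms(1)] .
    have R2: "R2 M ul ur x = R_ARZ M ul ur x"
      using assms True by (auto simp: R2_def R1_def)
    show ?thesis
    proof (cases "vel ur < vel ul")
      case True
      have "flow um < flow ul" "rho ul < rho um"
        using flow_lax_less[OF w ur(3) True] lax_density_antimono[OF w ur(3) True] ul(1) v
          vel_u_f(1)[OF w] by (metis um_def, metis um_def lax_simps(1))
      then have "sigma ul um < 0"
        using sigma_sign(2)[of ul um] by simp
      then show ?thesis
        using R2 True ur(3) by (simp add: R_ARZ_eq wave1_def um_def)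
    next
      case False
      then have "um = ul" "0 < vel ur"
        using ul(1) ur v limits by (auto simp: um_def)
      moreover have "sigma ul ul = 0"
        by (simp add: sigma_def)
      ultimately show ?thesis
        using R2 False by (simp add: R_ARZ_eq wave1_def um_def)
    qed
  next
    case False
    then have "R2 M ul ur x = (if x < sigma ul um then ul else R_ARZ M um ur x)"
      using assms by (auto simp: R2_def R1_def um_def lax_def Let_def)
    then show ?thesis
      using R_ARZ_contact[OF w assms(2)] by (simp add: um_def)
  qed
qed

text \<open>The vacuum has neither density nor flow, so that the jump to the middle state has the speed of
  this state, which is also the speed of the contact discontinuity: the middle state disappears.\<close>

lemma R2_vacuum:
  assumes "ul \<in> Omega_f M" "ur \<in> Omega_c M" "ur \<notin> Omega_f M" "rho ul = 0"
  shows "R2 M ul ur x = (if x < vel ur then ul else ur)"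
proof -
  have "0 < pinv M (mark M ul - vel ur)"
    using lax_Vc_density(3)[OF mark_Omega_f[OF assms(1)]] Omega_cD(3,4)[OF assms(2)] by simp
  then have "sigma ul (lax (mark M ul) (vel ur)) = vel ur"
    using assms(4) by (simp add: sigma_def flow_def)
  then show ?thesis
    using R2_free_congested[OF assms(1-3)] assms(4) by simp
qed

text \<open>States common to both phases count as free, except that on the right of a purely congested state
  they count as congested. Then exactly one description of \<open>R2\<close> applies in each case.\<close>

lemma Omega_cases [consumes 2, case_names free congested congested_free shock free_congested]:
  assumes "ul \<in> Omega M" "ur \<in> Omega M"
  obtains "ul \<in> Omega_f M" "ur \<in> Omega_f M"
  | "ul \<in> Omega_c M" "ul \<notin> Omega_f M" "ur \<in> Omega_c M"
  | "ul \<in> Omega_c M" "ul \<notin> Omega_f M" "ur \<in> Omega_f M" "ur \<notin> Omega_c M"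
  | "ul \<in> Omega_f M" "ur \<in> Omega_c M" "ur \<notin> Omega_f M" "rho ul \<noteq> 0" "mark M ul < mark M ur"
  | "ul \<in> Omega_f M" "ur \<in> Omega_c M" "ur \<notin> Omega_f M" "rho ul = 0 \<or> mark M ur \<le> mark M ul"
  using assms unfolding Omega_def by (metis Un_iff linorder_not_less)

section \<open>Traces of the unconstrained solver\<close>

lemma traces_free:
  assumes "ul \<in> Omega_f M" "ur \<in> Omega_f M"
  shows "trace_left (R2 M ul ur) = ul" "trace_right (R2 M ul ur) = ul"
proof -
  obtain \<delta> where "0 < \<delta>" "\<And>x. x < \<delta> \<Longrightarrow> R_LWR M ul ur x = ul"
    using lwr_ahead[OF assms] by blast
  then show "trace_left (R2 M ul ur) = ul" "trace_right (R2 M ul ur) = ul"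
    using R2_free[OF assms] by (auto intro!: trace_leftI[of 1] trace_rightI[of \<delta>])
qed

lemma traces_congested:
  assumes "ul \<in> Omega_c M" "ul \<notin> Omega_f M" "ur \<in> Omega_c M"
  shows "trace_left (R2 M ul ur) = lax (mark M ul) (vel ur)"
    "trace_right (R2 M ul ur) = (if 0 < vel ur then lax (mark M ul) (vel ur) else ur)"
proof -
  note ur = Omega_cD[OF assms(3)]
  obtain \<delta> where \<delta>: "\<delta> < 0" "\<And>x. \<delta> \<le> x \<Longrightarrow>
      wave1 M ul (lax (mark M ul) (vel ur)) x = lax (mark M ul) (vel ur)"
    using wave1_ahead[OF assms(1) ur(3,4)] by blast
  show "trace_left (R2 M ul ur) = lax (mark M ul) (vel ur)"
    using \<delta> R2_congested[OF assms] ur(3) by (intro trace_leftI[of "- \<delta>"]) (auto simp: R_ARZ_eq)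
  show "trace_right (R2 M ul ur) = (if 0 < vel ur then lax (mark M ul) (vel ur) else ur)"
    using \<delta> R2_congested[OF assms] ur(3)
    by (intro trace_rightI[of "if 0 < vel ur then vel ur else 1"]) (auto simp: R_ARZ_eq split: if_splits)
qed

text \<open>The phase transition stays within the curve of mark \<open>mark ul\<close>, hence it does not move
  forward, whereas the free-flow waves on its right do.\<close>

lemma trace_congested_free:
  assumes "ul \<in> Omega_c M" "ul \<notin> Omega_f M" "ur \<in> Omega_f M" "ur \<notin> Omega_c M"
  shows "trace_right (R2 M ul ur) = u_f M (mark M ul)"
proof -
  define w where "w = mark M ul"
  have w: "w \<in> marks" using Omega_cD(2)[OF assms(1)] by (simp add: w_def)
  note uf = vel_u_f[OF w]
  have "sigma (u_c M w) (u_f M w) \<le> 0"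
  proof (cases "Vc M = vel (u_f M w)")
    case True
    then show ?thesis
      using lax_u_f[OF w] by (simp add: u_c_lax sigma_def)
  next
    case False
    then have less: "Vc M < vel (u_f M w)" using uf(1) by simp
    have "flow (u_c M w) < flow (u_f M w)" "rho (u_f M w) < rho (u_c M w)"
      using flow_lax_less[OF w _ less] lax_density_antimono[OF w _ less] lax_u_f[OF w] limits(1)
      by (metis less_imp_le order_refl u_c_lax, metis less_imp_le order_refl u_c_lax lax_simps(1))
    then show ?thesis
      by (simp add: sigma_def divide_le_0_iff)
  qed
  moreover obtain \<delta> where "0 < \<delta>" "\<And>x. x < \<delta> \<Longrightarrow> R_LWR M (u_f M w) ur x = u_f M w"
    using lwr_ahead[OF uf(3) assms(3)] by blast
  ultimately show ?thesis
    using R2_congested_free[OF assms] by (intro trace_rightI[of \<delta>]) (auto simp: w_def)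
qed

lemma rho_less_shock:
  assumes "ul \<in> Omega_f M" "ur \<in> Omega_c M" "mark M ul < mark M ur"
  shows "rho ul < rho ur"
proof -
  note ur = Omega_cD[OF assms(2)]
  have "rho ul \<le> rho (lax (mark M ul) (vel ur))"
    using middle_state_denser[OF assms(1) ur(3,4)] by (metis less_imp_le order_refl)
  also have "\<dots> < rho ur"
    using rho_lax_less_mark[OF mark_Omega_f[OF assms(1)] ur(2) assms(3) ur(3,4)] ur(1)
    by (metis lax_simps(1))
  finally show ?thesis .
qed

lemma traces_shock:
  assumes "ul \<in> Omega_f M" "ur \<in> Omega_c M" "rho ul \<noteq> 0" "mark M ul < mark M ur"
  shows "flow (trace_left (R2 M ul ur)) \<le> flow ur" "flow (trace_right (R2 M ul ur)) \<le> flow ur"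
    "flow ul < flow ur \<Longrightarrow> trace_right (R2 M ul ur) = ul"
  using double_jump_traces[of "R2 M ul ur" ul ur 0 ur] R2_shock[OF assms]
    rho_less_shock[OF assms(1,2,4)] by auto

lemma traces_free_congested:
  assumes "ul \<in> Omega_f M" "ur \<in> Omega_c M" "ur \<notin> Omega_f M"
    and "rho ul = 0 \<or> mark M ur \<le> mark M ul"
  defines "um \<equiv> lax (mark M ul) (vel ur)"
  shows "flow (trace_left (R2 M ul ur)) \<le> flow um" "flow (trace_right (R2 M ul ur)) \<le> flow um"
    "flow ul < flow um \<Longrightarrow> trace_right (R2 M ul ur) = ul"
    "flow um \<le> flow ul \<Longrightarrow> 0 < vel ur \<Longrightarrow> trace_right (R2 M ul ur) = um"
proof -
  note ur = Omega_cD[OF assms(2)]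
  have "rho ul < rho um \<or> ul = um"
    using middle_state_denser[OF assms(1) ur(3,4)] by (simp add: um_def)
  moreover have "vel ur = 0 \<Longrightarrow> flow ur = flow um"
    by (simp add: flow_def um_def)
  moreover have "\<And>x. R2 M ul ur x = (if x < sigma ul um then ul else if x < vel ur then um else ur)"
    using R2_free_congested[OF assms(1-4)] by (simp add: um_def)
  ultimately show "flow (trace_left (R2 M ul ur)) \<le> flow um" "flow (trace_right (R2 M ul ur)) \<le> flow um"
    "flow ul < flow um \<Longrightarrow> trace_right (R2 M ul ur) = ul"
    "flow um \<le> flow ul \<Longrightarrow> 0 < vel ur \<Longrightarrow> trace_right (R2 M ul ur) = um"
    using double_jump_traces[of "R2 M ul ur" ul um "vel ur" ur] ur(3) by auto
qed

text \<open>At \<open>x = 0\<close> one sees either a state of speed \<open>vel ur\<close> on some Lax curve, whose flow is at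
  most that on the curve of mark \<open>Wmax\<close>, or a free state on the left of a forward jump towards
  such a state, which carries no more. If \<open>ur\<close> is free as well, its speed is \<open>Vc = Vmin\<close>, and
  the bound is \<open>qmax\<close>.\<close>

lemma trace_flow_le:
  assumes "ul \<in> Omega M" "ur \<in> Omega_c M"
  shows "flow (trace_left (R2 M ul ur)) \<le> flow (lax (Wmax M) (vel ur))"
    "flow (trace_right (R2 M ul ur)) \<le> flow (lax (Wmax M) (vel ur))"
proof -
  note ur = Omega_cD[OF assms(2)]
  have le: "flow (lax w (vel ur)) \<le> flow (lax (Wmax M) (vel ur))" if "w \<in> marks" for w
    using flow_lax_mono_mark[OF that marks_ends(2) _ ur(3,4)] that by simp
  have middle: "flow (lax (mark M ul) (vel ur)) \<le> flow (lax (Wmax M) (vel ur))"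
    using le mark_Omega[OF assms(1)] by simp
  have right: "flow ur \<le> flow (lax (Wmax M) (vel ur))"
    using le[OF ur(2)] ur(1) by simp
  have "ur \<in> Omega M" using assms(2) by (simp add: Omega_def)
  have "flow (trace_left (R2 M ul ur)) \<le> flow (lax (Wmax M) (vel ur)) \<and>
    flow (trace_right (R2 M ul ur)) \<le> flow (lax (Wmax M) (vel ur))"
    using assms(1) \<open>ur \<in> Omega M\<close>
  proof (cases rule: Omega_cases)
    case free
    have "vel ur = Vmin M"
      using Omega_c_free[OF assms(2) free(2)] by simp
    moreover have "pinv M (Wmax M - Vmin M) = Rf'' M"
      using pinv_p[of "Rf'' M"] radii by (simp add: Wmax_def)
    ultimately have "flow ul \<le> flow (lax (Wmax M) (vel ur))"
      using flow_le_qmax[OF free(1)] by (simp add: flow_lax qmax_def)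
    then show ?thesis
      using traces_free[OF free] by simp
  next
    case congested
    have "flow ur = 0" "flow (lax (mark M ul) (vel ur)) = 0" if "\<not> 0 < vel ur"
      using that ur(3) by (auto simp: flow_def)
    then show ?thesis
      using traces_congested[OF congested] middle by auto
  next
    case congested_free
    then show ?thesis using assms(2) by simp
  next
    case shock
    then show ?thesis
      using traces_shock[of ul ur] right by auto
  next
    case free_congested
    then show ?thesis
      using traces_free_congested[of ul ur] middle by auto
  qed
  then show "flow (trace_left (R2 M ul ur)) \<le> flow (lax (Wmax M) (vel ur))"
    "flow (trace_right (R2 M ul ur)) \<le> flow (lax (Wmax M) (vel ur))" by auto
qed

lemma C2_iff:
  "(ul, ur) \<in> C2 M \<longleftrightarrow> ul \<in> Omega M \<and> ur \<in> Omega M \<and>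
     flow (trace_left (R2 M ul ur)) \<le> Q0 M \<and> flow (trace_right (R2 M ul ur)) \<le> Q0 M"
  by (auto simp: C2_def)

lemma capacity_exceeds_Q0:
  assumes "ul \<in> Omega M" "ur \<in> Omega_c M" "(ul, ur) \<notin> C2 M"
  shows "Q0 M < flow (lax (Wmax M) (vel ur))" "Q0 M < flow (u_c M (Wmax M))" "0 < vel ur"
proof -
  note ur = Omega_cD[OF assms(2)]
  have "ur \<in> Omega M" using assms(2) by (simp add: Omega_def)
  then show 1: "Q0 M < flow (lax (Wmax M) (vel ur))"
    using assms(1,3) trace_flow_le[OF assms(1,2)] unfolding C2_iff by auto
  then show "Q0 M < flow (u_c M (Wmax M))"
    using flow_lax_mono[OF marks_ends(2) ur(3,4) vel_u_f(1)[OF marks_ends(2)]]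
    by (simp add: u_c_lax)
  show "0 < vel ur"
    using 1 ur(3) limits(3) by (cases "vel ur = 0") (auto simp: flow_lax)
qed

section \<open>The optimal pair\<close>

lemma congested_state_eqI:
  assumes "u \<in> Omega_c M" "u' \<in> Omega_c M" "mark M u = mark M u'" "flow u = flow u'"
  shows "u = u'"
proof -
  note u = Omega_cD[OF assms(1)] and u' = Omega_cD[OF assms(2)]
  have bound: "vel u \<le> vel (u_f M (mark M u))" "vel u' \<le> vel (u_f M (mark M u))"
    using vel_u_f(1)[OF u(2)] u(4) u'(4) by auto
  have "flow (lax (mark M u) (vel u)) = flow (lax (mark M u) (vel u'))"
    using u(1) u'(1) assms(3,4) by metis
  then have "vel u = vel u'"
    using flow_lax_less_iff[OF u(2,3) bound(1) u'(3) bound(2)]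
      flow_lax_less_iff[OF u(2) u'(3) bound(2) u(3) bound(1)] by linarith
  then show ?thesis
    using u(1) u'(1) assms(3) by metis
qed

lemma state_eqI_vel:
  assumes "vel u = vel u'" "flow u = flow u'" "vel u \<noteq> 0"
  shows "u = u'"
  using assms by (simp add: flow_def prod_eq_iff)

text \<open>At fixed speed the flow determines the density \<open>q / v\<close>, and the bounds on the flow are bounds
  on the mark.\<close>

lemma state_of_flow_and_vel:
  assumes "w \<in> marks" "w' \<in> marks" "0 < v" "v \<le> Vc M"
    and "flow (lax w v) \<le> q" "q \<le> flow (lax w' v)"
  obtains z where "z \<in> Omega_c M" "flow z = q" "vel z = v" "w \<le> mark M z"
proof -
  define r where "r = q / v"
  have v: "0 \<le> v" using assms by simp
  note l = lax_Vc_density[OF assms(1) v assms(4)] and l' = lax_Vc_density[OF assms(2) v assms(4)]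
  have r: "pinv M (w - v) \<le> r" "r \<le> pinv M (w' - v)"
    using assms by (auto simp: r_def flow_lax pos_le_divide_eq pos_divide_le_eq)
  then have "0 < r" using l(3) by simp
  have p: "w - v \<le> p M r" "p M r \<le> w' - v"
    using r l l' p_le_iff[of "pinv M (w - v)" r] p_le_iff[of r "pinv M (w' - v)"] \<open>0 < r\<close> by auto
  then have m: "v + p M r \<in> marks"
    using assms by auto
  have z: "lax (v + p M r) v = (r, v)"
    using pinv_p[OF \<open>0 < r\<close>] by (simp add: lax_def)
  show thesis
    using that[of "(r, v)"] lax_in_Omega_c[OF m v assms(4)] p assms(3)
    unfolding z by (simp add: flow_def r_def)
qed

text \<open>If the curve of mark \<open>w\<close> carries the flow \<open>q\<close>, the optimal left state lies on this curve.
  Otherwise it is the state of speed \<open>Vc\<close> and flow \<open>q\<close>, because the flow on a curve is largest at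
  the speed \<open>Vc\<close>.\<close>

lemma optimal_left_state:
  assumes w: "w \<in> marks" and q: "0 < q" "q \<le> flow (u_c M (Wmax M))"
  obtains a where "a \<in> Omega_c M" "flow a = q" "w \<le> mark M a"
    "\<And>u. u \<in> Omega_c M \<Longrightarrow> flow u = q \<Longrightarrow> w \<le> mark M u \<Longrightarrow> u \<noteq> a \<Longrightarrow> mark M a < mark M u"
proof (cases "q \<le> flow (u_c M w)")
  case True
  define r0 where "r0 = pinv M (w - Vc M)"
  define r1 where "r1 = pinv M (w - 0)"
  have r0: "p M r0 = w - Vc M" "0 < r0" and r1: "p M r1 = w" "0 < r1"
    using lax_Vc_density[OF w, of "Vc M"] lax_Vc_density[OF w, of 0] limits
    by (auto simp: r0_def r1_def)
  have le: "r0 \<le> r1"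
    using p_le_iff[of r0 r1] r0 r1 limits by simp
  have "continuous_on {r0..r1} (\<lambda>r. r * (w - p M r))"
    by (intro continuous_intros continuous_on_subset[OF p_continuous]) (use r0 in auto)
  moreover have "q \<le> r0 * (w - p M r0)" "r1 * (w - p M r1) \<le> q"
    using True q r0(1) r1(1) by (auto simp: u_c_lax flow_lax r0_def)
  ultimately obtain r where r: "r0 \<le> r" "r \<le> r1" "r * (w - p M r) = q"
    using IVT2'[of "\<lambda>r. r * (w - p M r)" r1 q r0] le by auto
  define v where "v = w - p M r"
  have "0 < r" using r r0 by simp
  then have v: "0 \<le> v" "v \<le> Vc M"
    using p_le_iff[of r0 r] p_le_iff[of r r1] r r0 r1 by (auto simp: v_def)
  have "flow (lax w v) = q"
    using pinv_p[OF \<open>0 < r\<close>] r(3) by (simp add: flow_lax v_def)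
  moreover note a = lax_in_Omega_c[OF w v]
  moreover have "w < mark M u" if "u \<in> Omega_c M" "flow u = q" "w \<le> mark M u" "u \<noteq> lax w v" for u
    using congested_state_eqI[OF that(1) a(1)] that a(2) calculation(1) by force
  ultimately show thesis
    using that[of "lax w v"] by simp
next
  case False
  have Vc: "0 < Vc M" "0 \<le> Vc M" using limits by auto
  obtain a where a: "a \<in> Omega_c M" "flow a = q" "vel a = Vc M" "w \<le> mark M a"
    using state_of_flow_and_vel[OF w marks_ends(2) Vc(1) order_refl, of q] False q
    by (auto simp: u_c_lax)
  have "mark M a < mark M u" if u: "u \<in> Omega_c M" "flow u = q" "u \<noteq> a" for u
  proof (rule ccontr)
    assume "\<not> mark M a < mark M u"
    moreover have "mark M u \<noteq> mark M a"
      using congested_state_eqI[OF u(1) a(1)] u a by auto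
    ultimately have less: "mark M u < mark M a" by simp
    note D = Omega_cD[OF u(1)]
    have "flow u \<le> flow (lax (mark M u) (Vc M))"
      using flow_lax_mono[OF D(2,3,4) vel_u_f(1)[OF D(2)]] D(1) by simp
    also have "\<dots> < flow (lax (mark M a) (Vc M))"
      using flow_lax_less_mark[OF D(2) Omega_cD(2)[OF a(1)] less Vc(1)] by simp
    also have "\<dots> = flow a"
      using Omega_cD(1)[OF a(1)] a(3) by simp
    finally show False using u a by simp
  qed
  then show thesis
    using that a by blast
qed

text \<open>The part of admissibility that concerns the right state of a pair. It does not involve the
  left state, and \<open>ul\<close> only restricts the latter.\<close>

definition right_candidates :: "state \<Rightarrow> real \<Rightarrow> state set" where
  "right_candidates ur q = {z \<in> Omega M. trace_right (R2 M z ur) = z \<and> flow z = q}"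

text \<open>A purely congested state next to a free one emits a phase transition, so that the state seen at
  \<open>x = 0\<close> is free.\<close>

lemma right_candidate_of_free:
  assumes "ur \<in> Omega_f M" "ur \<notin> Omega_c M" "0 \<le> q" "q \<le> qmax M"
  obtains b where "b \<in> Omega_f M" "right_candidates ur q = {b}"
proof -
  obtain b where b: "b \<in> Omega_f M" "flow b = q"
    using free_state_of_flow[OF assms(3,4)] .
  have "z = b" if z: "z \<in> Omega M" "trace_right (R2 M z ur) = z" "flow z = q" for z
  proof -
    have "z \<in> Omega_f M"
    proof (rule ccontr)
      assume nf: "z \<notin> Omega_f M"
      then have c: "z \<in> Omega_c M" using z(1) by (simp add: Omega_def)
      then have "z = u_f M (mark M z)"
        using trace_congested_free[OF c nf assms(1,2)] z(2) by simp
      then show False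
        using vel_u_f(3)[OF Omega_cD(2)[OF c]] nf by simp
    qed
    then show ?thesis
      using free_state_eqI[OF _ b(1)] z(3) b(2) by simp
  qed
  moreover have "b \<in> right_candidates ur q"
    using b traces_free(2)[OF b(1) assms(1)] by (auto simp: right_candidates_def Omega_def)
  ultimately have "right_candidates ur q = {b}"
    by (auto simp: right_candidates_def)
  then show thesis using that b by blast
qed

lemma congested_candidate_vel:
  assumes "z \<in> right_candidates ur q" "z \<in> Omega_c M" "z \<notin> Omega_f M" "ur \<in> Omega_c M" "0 < vel ur"
  shows "z = lax (mark M z) (vel ur)"
  using traces_congested(2)[OF assms(2-4)] assms(1,5) by (simp add: right_candidates_def)

text \<open>Of a given flow, the state of speed \<open>vel ur\<close> has a larger mark than every candidate in
  free flow, because the flow on the curve of such a candidate decreases towards \<open>vel ur\<close>. Only the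
  states of \<open>Omega_f'\<close>, whose mark is \<open>Wc\<close> by convention, can tie with it.\<close>

lemma right_candidate_congested:
  assumes ur: "ur \<in> Omega_c M" "0 < vel ur" and q: "0 < q" "flow (lax (Wc M) (vel ur)) \<le> q"
    "q \<le> flow (lax (Wmax M) (vel ur))"
  obtains b where "b \<in> Omega_c M" "vel b = vel ur" "b \<in> right_candidates ur q"
    "\<And>z. z \<in> right_candidates ur q \<Longrightarrow> z \<noteq> b \<Longrightarrow>
        mark M z < mark M b \<or> mark M z = mark M b \<and> b \<in> Omega_c M \<and> z \<notin> Omega_c M"
proof -
  note r = Omega_cD[OF ur(1)]
  obtain b where b: "b \<in> Omega_c M" "flow b = q" "vel b = vel ur" "Wc M \<le> mark M b"
    using state_of_flow_and_vel[OF marks_ends ur(2) r(4) q(2,3)] by blast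
  note B = Omega_cD[OF b(1)]
  have lax_b: "lax (mark M b) (vel ur) = b"
    using B(1) b(3) by simp
  have \<Omega>: "b \<in> Omega M" "ur \<in> Omega M" using b(1) ur(1) by (auto simp: Omega_def)
  then have "trace_right (R2 M b ur) = b"
  proof (cases rule: Omega_cases)
    case free
    then show ?thesis using traces_free by simp
  next
    case congested
    then show ?thesis using traces_congested(2)[OF congested] ur(2) lax_b by simp
  next
    case congested_free
    then show ?thesis using ur(1) by simp
  next
    case shock
    have "flow b < flow ur"
      using rho_less_shock[of b ur] shock b(3) ur(2) by (simp add: flow_def)
    then show ?thesis using traces_shock(3)[of b ur] shock by simp
  next
    case free_congested
    then show ?thesis using traces_free_congested(4)[of b ur] ur(2) lax_b by simp
  qed
  then have cand: "b \<in> right_candidates ur q"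
    using \<Omega> b(2) by (simp add: right_candidates_def)
  have "mark M z < mark M b \<or> mark M z = mark M b \<and> b \<in> Omega_c M \<and> z \<notin> Omega_c M"
    if z: "z \<in> right_candidates ur q" "z \<noteq> b" for z
  proof -
    have flow: "flow z = q" and z\<Omega>: "z \<in> Omega M"
      using z(1) by (auto simp: right_candidates_def)
    have vel: "vel z \<noteq> vel ur"
      using state_eqI_vel[of z b] b flow ur(2) z(2) by auto
    have free: "z \<in> Omega_f M"
    proof (rule ccontr)
      assume nf: "z \<notin> Omega_f M"
      then have "z \<in> Omega_c M" using z\<Omega> by (simp add: Omega_def)
      then have "vel z = vel ur"
        using congested_candidate_vel[OF z(1) _ nf ur] by (metis lax_simps(2))
      then show False using vel by simp
    qed
    then show ?thesis
    proof (cases rule: Omega_f_cases)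
      case 1
      have "z \<notin> Omega_c M" using Omega_c_not_f'[of z] 1 by auto
      then show ?thesis
        using Omega_f'D(3)[OF 1] b(1,4) by auto
    next
      case 2
      have w: "mark M z \<in> marks" and uf: "u_f M (mark M z) = z"
        using mark_Omega_f[OF free] u_f_mark[OF 2] by auto
      have "vel ur < vel z"
        using vel Omega_fD(5)[OF free] r(4) by linarith
      then have "flow (lax (mark M z) (vel ur)) < flow z"
        using flow_lax_less[OF w r(3), of "vel z"] lax_u_f[OF w] uf by simp
      moreover have "flow z = flow (lax (mark M b) (vel ur))"
        using flow b(2) lax_b by simp
      ultimately have "mark M z < mark M b"
        using flow_lax_mono_mark[OF B(2) w _ r(3,4)] by linarith
      then show ?thesis by simp
    qed
  qed
  then show thesis
    using that b cand by blast
qed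

text \<open>If all curves carry more than \<open>q\<close> at the speed of \<open>ur\<close>, the jump away from the free state of
  flow \<open>q\<close> moves forward, and no congested state of flow \<open>q\<close> has the speed of \<open>ur\<close>.\<close>

lemma right_candidate_free_congested:
  assumes ur: "ur \<in> Omega_c M" "0 < vel ur" and q: "0 \<le> q" "q \<le> qmax M"
    "q < flow (lax (Wc M) (vel ur))"
  obtains b where "b \<in> Omega_f M" "right_candidates ur q = {b}"
proof -
  note r = Omega_cD[OF ur(1)]
  have above: "q < flow (lax w (vel ur))" if "w \<in> marks" for w
    using flow_lax_mono_mark[OF marks_ends(1) that _ r(3,4)] that q(3) by simp
  obtain b where b: "b \<in> Omega_f M" "flow b = q"
    using free_state_of_flow[OF q(1,2)] .
  have \<Omega>: "b \<in> Omega M" "ur \<in> Omega M" using b(1) ur(1) by (auto simp: Omega_def)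
  then have "trace_right (R2 M b ur) = b"
  proof (cases rule: Omega_cases)
    case free
    then show ?thesis using traces_free by simp
  next
    case shock
    have "flow b < flow ur"
      using above[OF r(2)] r(1) b(2) by simp
    then show ?thesis using traces_shock(3)[of b ur] shock by simp
  next
    case free_congested
    then show ?thesis
      using traces_free_congested(3)[of b ur] above[OF mark_Omega[OF \<Omega>(1)]] b(2) by simp
  qed (use b ur in auto)
  then have "b \<in> right_candidates ur q"
    using \<Omega> b(2) by (simp add: right_candidates_def)
  moreover have "z = b" if z: "z \<in> right_candidates ur q" for z
  proof -
    have flow: "flow z = q" and z\<Omega>: "z \<in> Omega M"
      using z by (auto simp: right_candidates_def)
    have "z \<in> Omega_f M"
    proof (rule ccontr)
      assume nf: "z \<notin> Omega_f M"
      then have c: "z \<in> Omega_c M" using z\<Omega> by (simp add: Omega_def)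
      then show False
        using congested_candidate_vel[OF z c nf ur] above[OF Omega_cD(2)[OF c]] flow by simp
    qed
    then show ?thesis
      using free_state_eqI[OF _ b(1)] flow b(2) by simp
  qed
  ultimately have "right_candidates ur q = {b}" by blast
  then show thesis using that b by blast
qed

text \<open>Admissible pairs form a product, and a pair beats another one through either component. Comparing
  with the pairs that differ in one component only shows that each component is optimal by itself,
  and conversely.\<close>

lemma constrained_pair_eq:
  assumes adm: "(a, b) \<in> admissible_pairs M ul ur"
    and a: "\<And>a'. (a', b) \<in> admissible_pairs M ul ur \<Longrightarrow> a' \<noteq> a \<Longrightarrow> mark M a < mark M a'"
    and b: "\<And>b'. (a, b') \<in> admissible_pairs M ul ur \<Longrightarrow> b' \<noteq> b \<Longrightarrow>
      mark M b' < mark M b \<or> mark M b' = mark M b \<and> b \<in> Omega_c M \<and> b' \<notin> Omega_c M"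
  shows "constrained_pair M ul ur = (a, b)"
  unfolding constrained_pair_def
proof (rule the_equality)
  have mix: "(c', d) \<in> admissible_pairs M ul ur" "(c, d') \<in> admissible_pairs M ul ur"
    if "(c, d) \<in> admissible_pairs M ul ur" "(c', d') \<in> admissible_pairs M ul ur" for c d c' d'
    using that by (auto simp: admissible_pairs_def)
  have "better_pair M (a, b) (c, d) \<or> tie_break M (a, b) (c, d)"
    if cd: "(c, d) \<in> admissible_pairs M ul ur" "(c, d) \<noteq> (a, b)" for c d
  proof (cases "c = a")
    case True
    then show ?thesis
      using b[of d] cd by (auto simp: better_pair_def tie_break_def)
  next
    case False
    then show ?thesis
      using a[of c] mix(2)[OF cd(1) adm] by (auto simp: better_pair_def)
  qed
  then show "(a, b) \<in> admissible_pairs M ul ur \<and>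
    (\<forall>s'\<in>admissible_pairs M ul ur - {(a, b)}. better_pair M (a, b) s' \<or> tie_break M (a, b) s')"
    using adm by auto
  fix s assume s: "s \<in> admissible_pairs M ul ur \<and>
    (\<forall>s'\<in>admissible_pairs M ul ur - {s}. better_pair M s s' \<or> tie_break M s s')"
  obtain c d where cd: "s = (c, d)" by (cases s)
  have s_adm: "(c, d) \<in> admissible_pairs M ul ur" using s cd by simp
  note m = mix[OF adm s_adm]
  have opt: "better_pair M (c, d) s' \<or> tie_break M (c, d) s'"
    if "s' \<in> admissible_pairs M ul ur" "s' \<noteq> (c, d)" for s'
    using s cd that by auto
  have "c = a"
  proof (rule ccontr)
    assume "c \<noteq> a"
    then show False
      using opt[OF m(2)] a[OF m(1)] by (auto simp: better_pair_def tie_break_def)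
  qed
  moreover have "d = b"
  proof (rule ccontr)
    assume "d \<noteq> b"
    then show False
      using opt[OF m(1)] b[OF m(2)] by (auto simp: better_pair_def tie_break_def)
  qed
  ultimately show "s = (a, b)" using cd by simp
qed

text \<open>If the constraint is active with a congested \<open>ur\<close>, the prescribed flow is \<open>Q0\<close> itself.
  The right state then has the speed of \<open>ur\<close> unless even the curve of smallest mark carries more
  than \<open>Q0\<close> at this speed.\<close>

lemma constrained_pair_cases:
  assumes ul: "ul \<in> Omega M" and ur: "ur \<in> Omega M" and nC: "(ul, ur) \<notin> C2 M"
  defines "q \<equiv> min (Q0 M) (flow (u_c M (Wmax M)))"
  obtains a b where "constrained_pair M ul ur = (a, b)" "a \<in> Omega_c M" "b \<in> Omega M"
    "flow a = q" "flow b = q" "mark M ul \<le> mark M a"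
    "ur \<notin> Omega_c M \<Longrightarrow> b \<in> Omega_f M"
    "ur \<in> Omega_c M \<Longrightarrow> flow (lax (Wc M) (vel ur)) \<le> Q0 M \<Longrightarrow> b \<in> Omega_c M \<and> vel b = vel ur"
    "ur \<in> Omega_c M \<Longrightarrow> Q0 M < flow (lax (Wc M) (vel ur)) \<Longrightarrow> b \<in> Omega_f M"
proof -
  have pos: "0 < flow (u_c M (Wmax M))"
    using lax_Vc_density(3)[OF marks_ends(2), of "Vc M"] limits by (simp add: u_c_lax flow_lax)
  have q: "0 < q" "0 \<le> q" "q \<le> qmax M" "q \<le> flow (u_c M (Wmax M))"
    using limits pos by (auto simp: q_def)
  obtain a where a: "a \<in> Omega_c M" "flow a = q" "mark M ul \<le> mark M a"
    and a_opt: "\<And>u. u \<in> Omega_c M \<Longrightarrow> flow u = q \<Longrightarrow> mark M ul \<le> mark M u \<Longrightarrow> u \<noteq> a \<Longrightarrow>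
      mark M a < mark M u"
    using optimal_left_state[OF mark_Omega[OF ul] q(1,4)] by metis
  have adm: "(c, d) \<in> admissible_pairs M ul ur \<longleftrightarrow>
      c \<in> Omega_c M \<and> flow c = q \<and> mark M ul \<le> mark M c \<and> d \<in> right_candidates ur q" for c d
    by (auto simp: admissible_pairs_def right_candidates_def q_def)
  have q_Q0: "q = Q0 M" if "ur \<in> Omega_c M"
    using capacity_exceeds_Q0(2)[OF ul that nC] by (simp add: q_def)
  obtain b where b: "b \<in> right_candidates ur q"
    and b_opt: "\<And>z. z \<in> right_candidates ur q \<Longrightarrow> z \<noteq> b \<Longrightarrow>
      mark M z < mark M b \<or> mark M z = mark M b \<and> b \<in> Omega_c M \<and> z \<notin> Omega_c M"
    and b_free: "ur \<notin> Omega_c M \<Longrightarrow> b \<in> Omega_f M"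
    and b_cong: "ur \<in> Omega_c M \<Longrightarrow> flow (lax (Wc M) (vel ur)) \<le> q \<Longrightarrow> b \<in> Omega_c M \<and> vel b = vel ur"
    and b_free_cong: "ur \<in> Omega_c M \<Longrightarrow> q < flow (lax (Wc M) (vel ur)) \<Longrightarrow> b \<in> Omega_f M"
  proof (cases "ur \<in> Omega_c M")
    case False
    then have "ur \<in> Omega_f M" using ur by (simp add: Omega_def)
    then obtain b where "b \<in> Omega_f M" "right_candidates ur q = {b}"
      using right_candidate_of_free[OF _ False q(2,3)] by blast
    then show ?thesis using that[of b] False by auto
  next
    case True
    note cap = capacity_exceeds_Q0[OF ul True nC]
    show ?thesis
    proof (cases "flow (lax (Wc M) (vel ur)) \<le> q")
      case le: True
      have "q \<le> flow (lax (Wmax M) (vel ur))"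
        using cap(1) q_Q0[OF True] by simp
      then obtain b where "b \<in> Omega_c M" "vel b = vel ur" "b \<in> right_candidates ur q"
        "\<And>z. z \<in> right_candidates ur q \<Longrightarrow> z \<noteq> b \<Longrightarrow>
          mark M z < mark M b \<or> mark M z = mark M b \<and> b \<in> Omega_c M \<and> z \<notin> Omega_c M"
        using right_candidate_congested[OF True cap(3) q(1) le] by metis
      then show ?thesis using that[of b] True le by simp
    next
      case gt: False
      then have "q < flow (lax (Wc M) (vel ur))" by simp
      then obtain b where "b \<in> Omega_f M" "right_candidates ur q = {b}"
        using right_candidate_free_congested[OF True cap(3) q(2,3)] by metis
      then show ?thesis using that[of b] True gt by simp
    qed
  qed
  have "constrained_pair M ul ur = (a, b)"
    by (rule constrained_pair_eq) (use a a_opt b b_opt adm in blast)+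
  moreover have "b \<in> Omega M" "flow b = q"
    using b by (auto simp: right_candidates_def)
  ultimately show thesis
    using that[of a b] a b_free b_cong b_free_cong q_Q0 by metis
qed

section \<open>Invariant domains\<close>

text \<open>The left part of the constrained solution uses \<open>R2 ul a\<close>, or, before the extra jump to \<open>a\<close> from
  \<open>u_f (mark ul)\<close>, the unconstrained solution towards \<open>u_f (mark ul)\<close>.\<close>

lemma invariant_domainI:
  assumes "D \<subseteq> Omega M"
    and compliant: "\<And>ul ur x. ul \<in> D \<Longrightarrow> ur \<in> D \<Longrightarrow> (ul, ur) \<in> C2 M \<Longrightarrow> R2 M ul ur x \<in> D"
    and left: "\<And>ul ur a b x. ul \<in> D \<Longrightarrow> ur \<in> D \<Longrightarrow> (ul, ur) \<notin> C2 M \<Longrightarrow>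
      constrained_pair M ul ur = (a, b) \<Longrightarrow> a \<in> D \<and> R2 M ul a x \<in> D"
    and right: "\<And>ul ur a b x. ul \<in> D \<Longrightarrow> ur \<in> D \<Longrightarrow> (ul, ur) \<notin> C2 M \<Longrightarrow>
      constrained_pair M ul ur = (a, b) \<Longrightarrow> R2 M b ur x \<in> D"
    and transition: "\<And>ul ur x. ul \<in> D \<Longrightarrow> ur \<in> D \<Longrightarrow> (ul, ur) \<notin> C2 M \<Longrightarrow>
      ul \<in> Omega_c M \<Longrightarrow> ur \<in> Omega_f M \<Longrightarrow> flow (u_c M (mark M ul)) < Q0 M \<Longrightarrow>
      R2 M ul (u_f M (mark M ul)) x \<in> D"
  shows "invariant_domain M D"
proof -
  have "R2c M ul ur x \<in> D" if "ul \<in> D" "ur \<in> D" for ul ur x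
  proof -
    obtain a b where "constrained_pair M ul ur = (a, b)"
      by (cases "constrained_pair M ul ur")
    then show ?thesis
      using compliant[OF that, of x] left[OF that, of a b x] right[OF that, of a b x]
        transition[OF that, of x]
      by (auto simp: R2c_def Let_def N3_def)
  qed
  then show ?thesis
    using assms(1) by (auto simp: invariant_domain_def)
qed

lemma flow_u_f_ge:
  assumes "w \<in> marks"
  shows "flow (u_c M w) \<le> flow (u_f M w)"
  using flow_lax_mono[OF assms _ vel_u_f(1)[OF assms] order_refl] lax_u_f[OF assms] limits
  by (simp add: u_c_lax)

lemma flow_u_c_mono:
  assumes "w \<in> marks" "w' \<in> marks" "w \<le> w'"
  shows "flow (u_c M w) \<le> flow (u_c M w')"
  using flow_lax_mono_mark[OF assms, of "Vc M"] limits by (simp add: u_c_lax)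

lemma flow_le_u_c:
  assumes "u \<in> Omega_c M"
  shows "flow u \<le> flow (u_c M (mark M u))"
  using flow_lax_mono[OF Omega_cD(2,3,4)[OF assms] vel_u_f(1)[OF Omega_cD(2)[OF assms]]]
    Omega_cD(1)[OF assms] by (simp add: u_c_lax)

lemma R2_free_in_Omega_f:
  assumes "ul \<in> Omega_f M" "ur \<in> Omega_f M"
  shows "R2 M ul ur x \<in> Omega_f M"
  using lwr_states(1)[OF assms] R2_free[OF assms] by simp

lemma R_ARZ_states:
  assumes "ul \<in> Omega_c M" "ur \<in> Omega_c M"
  shows "R_ARZ M ul ur x \<in> {ul, ur, lax (mark M ul) (vel ur)} \<union> lax (mark M ul) ` {vel ul..vel ur}"
  using wave1_states[OF assms(1) Omega_cD(3,4)[OF assms(2)], of x] by (auto simp: R_ARZ_eq)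

lemma R_ARZ_in_Omega_c:
  assumes "ul \<in> Omega_c M" "ur \<in> Omega_c M"
  shows "R_ARZ M ul ur x \<in> Omega_c M"
  using R_ARZ_states[OF assms, of x] assms middle_state(1)[of ul ur] Omega_cD(3,4)[OF assms(2)]
    Omega_cD(2,3)[OF assms(1)] by (auto simp: Omega_def intro!: lax_in_Omega_c(1))

subsection \<open>The congested phase\<close>

lemma free_in_Omega_c:
  assumes "u \<in> Omega_f'' M" "vel u = Vc M"
  shows "u \<in> Omega_c M"
  using lax_in_Omega_c(1)[OF mark_Omega_f[OF Omega_f''D(1)[OF assms(1)]], of "Vc M"] limits
    lax_u_f[OF mark_Omega_f[OF Omega_f''D(1)[OF assms(1)]]] u_f_mark[OF assms(1)] assms(2) by simp

text \<open>States common to both phases have the speed \<open>Vc = Vmin\<close>, hence so have the free-flow states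
  between them.\<close>

lemma R2_congested_in_Omega_c:
  assumes "ul \<in> Omega_c M" "ur \<in> Omega_c M"
  shows "R2 M ul ur x \<in> Omega_c M"
proof -
  have "ul \<in> Omega M" "ur \<in> Omega M" using assms by (auto simp: Omega_def)
  then show ?thesis
  proof (cases rule: Omega_cases)
    case free
    define u where "u = R_LWR M ul ur x"
    have u: "u \<in> Omega_f M" "Rf' M \<le> rho u" "rho u \<le> max (rho ul) (rho ur)"
      using lwr_states[OF free, of x] Omega_cD(5)[OF assms(1)] Omega_cD(5)[OF assms(2)]
      by (auto simp: u_def)
    have "vel u \<le> Vc M"
      using Omega_fD(2,4)[OF u(1)] Omega_c_free(2,3)[OF assms(1) free(1)]
        Omega_fD(3)[OF u(1)] V_antimono[of "min (rho ul) (rho ur)" "rho u"] lwr_states(2)[OF free, of x]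
        Omega_fD(1,3)[OF free(1)] Omega_fD(1,3)[OF free(2)] Omega_c_free(2)[OF assms(2) free(2)]
      by (auto simp: u_def min_def split: if_splits)
    then have "vel u = Vc M"
      using Omega_fD(5)[OF u(1)] by simp
    moreover have "u \<in> Omega_f'' M"
      using u by (simp add: Omega_f''_def)
    ultimately show ?thesis
      using free_in_Omega_c[of u] R2_free[OF free] by (simp add: u_def)
  next
    case congested
    then show ?thesis
      using R2_congested[OF congested] R_ARZ_in_Omega_c[OF assms] by simp
  next
    case congested_free
    then show ?thesis using assms by simp
  next
    case shock
    then show ?thesis using R2_shock[of ul ur x] assms by simp
  next
    case free_congested
    then show ?thesis
      using R2_free_congested[of ul ur x] assms middle_state(1)[of ul ur] by (simp add: Omega_def)
  qed
qed

text \<open>For two congested states the constrained solver never passes through \<open>u_f (mark ul)\<close>, a state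
  which in general is not congested: if \<open>ur\<close> is free as well, its speed is \<open>Vc\<close>, and \<open>u_c (mark ul)\<close>
  is the state seen at \<open>x = 0\<close>. If its flow is at most \<open>Q0\<close>, the constraint is not active.\<close>

lemma congested_pair_overlap_in_C2:
  assumes "ul \<in> Omega_c M" "ur \<in> Omega_c M" "ur \<in> Omega_f M" "flow (u_c M (mark M ul)) \<le> Q0 M"
  shows "(ul, ur) \<in> C2 M"
proof -
  have vr: "vel ur = Vc M" "0 < vel ur" using Omega_c_free(2)[OF assms(2,3)] limits by auto
  have \<Omega>: "ul \<in> Omega M" "ur \<in> Omega M" using assms by (auto simp: Omega_def)
  then have "trace_left (R2 M ul ur) = u_c M (mark M ul) \<and> trace_right (R2 M ul ur) = u_c M (mark M ul)"
  proof (cases rule: Omega_cases)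
    case free
    then show ?thesis
      using traces_free[OF free] Omega_cD(1)[OF assms(1)] Omega_c_free(2)[OF assms(1) free(1)]
      by (simp add: u_c_lax)
  next
    case congested
    then show ?thesis using traces_congested[OF congested] vr by (simp add: u_c_lax)
  qed (use assms in auto)
  then show ?thesis
    using \<Omega> assms(4) by (simp add: C2_iff)
qed

text \<open>At a speed of at most \<open>Vc\<close> the curve of mark \<open>Wc\<close> carries at most \<open>Q0\<close>, so that the right state
  of the optimal pair is always congested.\<close>

theorem Omega_c_invariant:
  assumes "flow (u_c M (Wc M)) \<le> Q0 M"
  shows "invariant_domain M (Omega_c M)"
proof (rule invariant_domainI)
  fix ul ur a b x
  assume *: "ul \<in> Omega_c M" "ur \<in> Omega_c M" "(ul, ur) \<notin> C2 M" "constrained_pair M ul ur = (a, b)"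
  then have \<Omega>: "ul \<in> Omega M" "ur \<in> Omega M" by (auto simp: Omega_def)
  have "flow (lax (Wc M) (vel ur)) \<le> Q0 M"
    using flow_lax_mono[OF marks_ends(1) Omega_cD(3,4)[OF *(2)] vel_u_f(1)[OF marks_ends(1)]] assms
    by (simp add: u_c_lax)
  then have "a \<in> Omega_c M" "b \<in> Omega_c M"
    using constrained_pair_cases[OF \<Omega> *(3)] *(2,4) by (metis Pair_inject)+
  then show "a \<in> Omega_c M \<and> R2 M ul a x \<in> Omega_c M" "R2 M b ur x \<in> Omega_c M"
    using R2_congested_in_Omega_c * by auto
next
  fix ul ur x
  assume "ul \<in> Omega_c M" "ur \<in> Omega_c M" "(ul, ur) \<notin> C2 M" "ur \<in> Omega_f M"
    "flow (u_c M (mark M ul)) < Q0 M"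
  then show "R2 M ul (u_f M (mark M ul)) x \<in> Omega_c M"
    using congested_pair_overlap_in_C2[of ul ur] by simp
qed (auto simp: Omega_def intro: R2_congested_in_Omega_c)

text \<open>The curve of mark \<open>Wc\<close> joins \<open>u_c Wc\<close> to the free state of density \<open>Rf'\<close>, with increasing flow.\<close>

lemma small_flow_in_Omega_f':
  assumes "u \<in> Omega_f M" "flow u < flow (u_c M (Wc M))"
  shows "u \<in> Omega_f' M"
proof -
  define s where "s = u_f M (Wc M)"
  have "(Rf' M, V M (Rf' M)) \<in> Omega_f'' M"
    using Omega_fI[of "Rf' M"] radii by (simp add: Omega_f''_def)
  then have "s = (Rf' M, V M (Rf' M))"
    using u_f_mark[of "(Rf' M, V M (Rf' M))"] Omega_f''D(3)[of "(Rf' M, V M (Rf' M))"]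
    by (simp add: s_def Wc_def add.commute)
  then have "rho s = Rf' M" by simp
  moreover have "flow u < flow s"
    using assms(2) flow_u_f_ge[OF marks_ends(1)] by (simp add: s_def)
  ultimately show ?thesis
    using flow_less_iff_rho_less[OF assms(1) vel_u_f(3)[OF marks_ends(1)]] assms(1)
    by (simp add: s_def Omega_f'_def)
qed

text \<open>There is only one free state of flow \<open>Q0\<close>, and it occurs as right state of the optimal pair. A
  solution from a congested state to it would show \<open>u_f (mark ul)\<close>, or \<open>ul\<close> itself, at \<open>x = 0\<close>. Both
  are denser and carry more than \<open>Q0\<close>, hence the constraint is active.\<close>

theorem Omega_c_with_free_state_invariant:
  assumes "Q0 M < flow (u_c M (Wc M))"
  shows "invariant_domain M (Omega_c M \<union> {u \<in> Omega_f' M. flow u = Q0 M})"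
    (is "invariant_domain M ?D")
proof -
  have q: "min (Q0 M) (flow (u_c M (Wmax M))) = Q0 M"
    using assms flow_u_c_mono[OF marks_ends] marks_ends(1) by simp
  have D: "u \<in> Omega M" if "u \<in> ?D" for u
    using that Omega_f'D(1)[of u] by (auto simp: Omega_def)
  \<comment> \<open>the remaining data, congested on the left and free on the right, always violate the constraint\<close>
  have R2: "R2 M ul ur x \<in> ?D" if "ul \<in> ?D" "ur \<in> ?D" "ul \<in> Omega_c M \<longrightarrow> ur \<in> Omega_c M" for ul ur x
  proof (cases "ul \<in> Omega_c M")
    case True
    then show ?thesis using R2_congested_in_Omega_c that(3) by blast
  next
    case False
    then have l: "ul \<in> Omega_f' M" "flow ul = Q0 M" using that(1) by auto
    note l' = Omega_f'D[OF l(1)]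
    show ?thesis
      using D[OF that(1)] D[OF that(2)]
    proof (cases rule: Omega_cases)
      case free
      have "rho ul < rho ur \<or> ul = ur"
      proof (cases "ur \<in> Omega_c M")
        case True
        then show ?thesis using Omega_cD(5)[OF True] l'(2) by simp
      next
        case False
        then show ?thesis using free_state_eqI[OF free] that(2) l(2) by auto
      qed
      then show ?thesis
        using R2_free[OF free] that by (auto simp: R_LWR_def)
    next
      case shock
      then show ?thesis using R2_shock[of ul ur x] that by simp
    next
      case free_congested
      then show ?thesis
        using R2_free_congested[of ul ur x] that middle_state(1)[OF D[OF that(1)], of ur] by simp
    qed (use False in auto)
  qed
  show ?thesis
  proof (rule invariant_domainI)
    fix ul ur x
    assume *: "ul \<in> ?D" "ur \<in> ?D" "(ul, ur) \<in> C2 M"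
    have "ur \<in> Omega_c M" if ul: "ul \<in> Omega_c M"
    proof (rule ccontr)
      assume nc: "ur \<notin> Omega_c M"
      then have r: "ur \<in> Omega_f' M" "flow ur = Q0 M" using *(2) by auto
      note r' = Omega_f'D[OF r(1)]
      have "\<exists>u\<in>Omega_f M. rho ur < rho u \<and> trace_right (R2 M ul ur) = u"
        using D[OF *(1)] D[OF *(2)]
      proof (cases rule: Omega_cases)
        case free
        then show ?thesis
          using traces_free(2)[OF free] Omega_cD(5)[OF ul] r'(2) by auto
      next
        case congested_free
        have w: "mark M ul \<in> marks" using Omega_cD(2)[OF ul] .
        then show ?thesis
          using trace_congested_free[OF congested_free] vel_u_f(3)[OF w]
            Omega_f''D(2)[OF u_f(1)[OF w]] r'(2) by auto
      qed (use nc in auto)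
      then have "Q0 M < flow (trace_right (R2 M ul ur))"
        using flow_less_iff_rho_less[OF r'(1)] r(2) by auto
      then show False
        using *(3) by (simp add: C2_iff)
    qed
    then show "R2 M ul ur x \<in> ?D" using R2[OF *(1,2)] by blast
  next
    fix ul ur a b x
    assume *: "ul \<in> ?D" "ur \<in> ?D" "(ul, ur) \<notin> C2 M" "constrained_pair M ul ur = (a, b)"
    obtain a' b' where pair: "constrained_pair M ul ur = (a', b')" "a' \<in> Omega_c M" "flow b' = Q0 M"
      "ur \<notin> Omega_c M \<Longrightarrow> b' \<in> Omega_f M" "b' \<in> Omega M"
      using constrained_pair_cases[OF D[OF *(1)] D[OF *(2)] *(3)] q by metis
    have ab: "a \<in> Omega_c M" "flow b = Q0 M" "ur \<notin> Omega_c M \<Longrightarrow> b \<in> Omega_f M" "b \<in> Omega M"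
      using pair *(4) by auto
    have free: "b \<in> Omega_f' M" if "b \<in> Omega_f M"
      using small_flow_in_Omega_f'[OF that] ab(2) assms by simp
    show "a \<in> ?D \<and> R2 M ul a x \<in> ?D"
      using R2[OF *(1), of a] ab(1) by blast
    have "b \<in> ?D" using ab(2,4) free by (auto simp: Omega_def)
    moreover have "ur \<in> Omega_c M" if "b \<in> Omega_c M"
      using ab(3) free Omega_c_not_f'[OF that] by blast
    ultimately show "R2 M b ur x \<in> ?D"
      using R2[OF _ *(2), of b] by blast
  next
    fix ul ur x
    assume *: "ul \<in> Omega_c M" "flow (u_c M (mark M ul)) < Q0 M"
    then have "flow (u_c M (Wc M)) \<le> flow (u_c M (mark M ul))"
      using flow_u_c_mono[OF marks_ends(1) Omega_cD(2)[OF *(1)]] Omega_cD(2)[OF *(1)] by simp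
    then show "R2 M ul (u_f M (mark M ul)) x \<in> ?D"
      using assms * by simp
  qed (use D in blast)
qed

subsection \<open>The free phase with congested states\<close>

text \<open>The flow of congested states increases strictly in the speed and, at the speed \<open>Vc\<close>, in the
  mark.\<close>

lemma max_congested_state_eqI:
  assumes "a \<in> Omega_c M" "flow a = flow (u_c M (Wmax M))"
  shows "a = u_c M (Wmax M)"
proof -
  note a = Omega_cD[OF assms(1)]
  have "\<not> mark M a < Wmax M"
    using flow_lax_less_mark[OF a(2) marks_ends(2), of "Vc M"] limits flow_le_u_c[OF assms(1)] assms(2)
    by (auto simp: u_c_lax)
  then have "mark M a = Wmax M" using a(2) by simp
  then show ?thesis
    using congested_state_eqI[OF assms(1) u_c_in_Omega_c(1)[OF marks_ends(2)]]
      u_c_in_Omega_c(2)[OF marks_ends(2)] assms(2) by simp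
qed

text \<open>The hypothesis excludes \<open>Vc = Vmin\<close>, where \<open>u_c Wmax\<close> would carry \<open>qmax > Q0\<close>, so that the phases
  are disjoint. A free state of smaller mark jumps to \<open>u_c Wmax\<close> directly, one of mark \<open>Wmax\<close>
  has \<open>u_c Wmax\<close> as its middle state, and after a vacuum the middle state disappears.
  The left state of the optimal pair has the flow of \<open>u_c Wmax\<close>, hence equals it.\<close>

theorem Omega_f_with_max_state_invariant:
  assumes "flow (u_c M (Wmax M)) \<le> Q0 M"
  shows "invariant_domain M (Omega_f M \<union> {u_c M (Wmax M)})" (is "invariant_domain M ?D")
proof -
  define um where "um = u_c M (Wmax M)"
  have um: "um \<in> Omega_c M" "mark M um = Wmax M" "vel um = Vc M" "lax (Wmax M) (Vc M) = um"
    using u_c_in_Omega_c[OF marks_ends(2)] by (auto simp: um_def u_c_lax)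
  have D: "u \<in> Omega M" if "u \<in> ?D" for u
    using that um(1) by (auto simp: Omega_def um_def)
  have is_um: "u = um" if "u \<in> ?D" "u \<notin> Omega_f M" for u
    using that by (auto simp: um_def)
  have "pinv M (Wmax M - Vmin M) = Rf'' M"
    using pinv_p[of "Rf'' M"] radii by (simp add: Wmax_def)
  then have "Vmin M \<noteq> Vc M"
    using assms limits by (auto simp: u_c_lax flow_lax qmax_def)
  then have disjoint: "u \<notin> Omega_f M" if "u \<in> Omega_c M" for u
    using Omega_c_free(3)[OF that] by blast
  have R2: "R2 M ul ur x \<in> ?D" if "ul \<in> ?D" "ur \<in> ?D" for ul ur x
    using D[OF that(1)] D[OF that(2)]
  proof (cases rule: Omega_cases)
    case free
    then show ?thesis using R2_free_in_Omega_f by simp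
  next
    case congested
    have "ul = um" "ur = um"
      using is_um[OF that(1) congested(2)] is_um[OF that(2) disjoint[OF congested(3)]] by auto
    then show ?thesis
      using R2_congested[OF congested] R_ARZ_states[OF um(1,1), of x] um by (auto simp: um_def)
  next
    case congested_free
    have "ul = um" using is_um[OF that(1) congested_free(2)] .
    then have "R_ARZ M ul (u_c M (mark M ul)) x = um"
      using R_ARZ_states[OF um(1,1), of x] um by (auto simp: um_def)
    moreover have "R_LWR M (u_f M (mark M ul)) ur x \<in> Omega_f M"
      using lwr_states(1)[OF vel_u_f(3)[OF Omega_cD(2)[OF congested_free(1)]] congested_free(3)] .
    ultimately show ?thesis
      using R2_congested_free[OF congested_free, of x] by (auto simp: um_def)
  next
    case shock
    then show ?thesis using R2_shock[of ul ur x] that by simp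
  next
    case free_congested
    have ur: "ur = um" using is_um[OF that(2) free_congested(3)] .
    show ?thesis
    proof (cases "rho ul = 0")
      case True
      then show ?thesis
        using R2_vacuum[of ul ur x] free_congested that by simp
    next
      case False
      then have "mark M ul = Wmax M"
        using free_congested(4) mark_Omega[OF D[OF that(1)]] um(2) ur by simp
      then show ?thesis
        using R2_free_congested[of ul ur x] free_congested that um ur by simp
    qed
  qed
  show ?thesis
  proof (rule invariant_domainI)
    fix ul ur a b x
    assume *: "ul \<in> ?D" "ur \<in> ?D" "(ul, ur) \<notin> C2 M" "constrained_pair M ul ur = (a, b)"
    have nc: "ur \<notin> Omega_c M"
      using capacity_exceeds_Q0(2)[OF D[OF *(1)] _ *(3)] assms by auto
    obtain a' b' where "constrained_pair M ul ur = (a', b')" "a' \<in> Omega_c M"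
      "flow a' = flow (u_c M (Wmax M))" "b' \<in> Omega_f M"
      using constrained_pair_cases[OF D[OF *(1)] D[OF *(2)] *(3)] nc assms by (metis min.absorb2)
    then have "a = u_c M (Wmax M)" "b \<in> Omega_f M"
      using *(4) max_congested_state_eqI[of a] by auto
    then show "a \<in> ?D \<and> R2 M ul a x \<in> ?D" "R2 M b ur x \<in> ?D"
      using R2[OF *(1), of a] R2[OF _ *(2), of b] by auto
  next
    fix ul ur x
    assume *: "ul \<in> ?D" "ul \<in> Omega_c M"
    show "R2 M ul (u_f M (mark M ul)) x \<in> ?D"
      using R2[OF *(1), of "u_f M (mark M ul)"] vel_u_f(3)[OF Omega_cD(2)[OF *(2)]] by blast
  qed (use D R2 in auto)
qed

text \<open>Middle states inherit the speed of \<open>ur\<close>, and the speeds in a fan grow from \<open>vel ul\<close>, so that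
  the second condition on congested states is preserved by waves; only the first one,
  \<open>flow u \<le> Q0\<close>, can fail, and it is decided by the middle state. For data that satisfy the
  constraint, the middle state is seen at \<open>x = 0\<close> or carries at most \<open>flow ur\<close>. The states of the
  optimal pair carry exactly \<open>Q0\<close>, and the middle states next to them at most \<open>Q0\<close>, by monotonicity
  in the mark on the left and equality of the speeds on the right.\<close>

theorem Omega_f_with_congested_states_invariant:
  assumes "Q0 M < flow (u_c M (Wmax M))"
  shows "invariant_domain M
    (Omega_f M \<union> {u \<in> Omega_c M. flow u \<le> Q0 M \<and> pinv M (Wmax M - vel u) * vel u \<ge> Q0 M})"
    (is "invariant_domain M ?D")
proof -
  define \<Delta> where "\<Delta> = {u \<in> Omega_c M. flow u \<le> Q0 M \<and> Q0 M \<le> flow (lax (Wmax M) (vel u))}"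
  have D_eq: "?D = Omega_f M \<union> \<Delta>"
    by (simp add: \<Delta>_def flow_lax)
  have \<Omega>: "u \<in> Omega M" if "u \<in> Omega_f M \<union> \<Delta>" for u
    using that by (auto simp: Omega_def \<Delta>_def)
  have \<Delta>I: "lax w v \<in> \<Delta>" if "w \<in> marks" "0 \<le> v" "v \<le> Vc M" "flow (lax w v) \<le> Q0 M"
    "Q0 M \<le> flow (lax (Wmax M) v)" for w v
    using lax_in_Omega_c(1)[OF that(1-3)] that by (simp add: \<Delta>_def)
  have capacity: "Q0 M \<le> flow (lax (Wmax M) (vel u))" if "u \<in> Omega_f M \<union> \<Delta>" "u \<in> Omega_c M" for u
    using that Omega_c_free(2)[OF that(2)] assms by (auto simp: \<Delta>_def u_c_lax)
  have of_flow_Q0: "u \<in> \<Delta>" if "u \<in> Omega_c M" "flow u = Q0 M" for u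
  proof -
    note u = Omega_cD[OF that(1)]
    have "flow u \<le> flow (lax (Wmax M) (vel u))"
      using flow_lax_mono_mark[OF u(2) marks_ends(2) _ u(3,4)] u(1,2) by simp
    then show ?thesis using that by (simp add: \<Delta>_def)
  qed
  \<comment> \<open>towards a congested state, all waves stay in the set if the middle state carries at most Q0\<close>
  have R2: "R2 M ul ur x \<in> Omega_f M \<union> \<Delta>"
    if ul: "ul \<in> Omega_f M \<union> \<Delta>" and ur: "ur \<in> Omega_f M \<union> \<Delta>" "ur \<in> Omega_c M"
      and flow: "flow (lax (mark M ul) (vel ur)) \<le> Q0 M" for ul ur x
  proof -
    note r = Omega_cD[OF ur(2)]
    have w: "mark M ul \<in> marks" using mark_Omega[OF \<Omega>[OF ul]] .
    have um: "lax (mark M ul) (vel ur) \<in> \<Delta>"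
      using \<Delta>I[OF w r(3,4) flow capacity[OF ur]] .
    show ?thesis
      using \<Omega>[OF ul] \<Omega>[OF ur(1)]
    proof (cases rule: Omega_cases)
      case free
      then show ?thesis using R2_free_in_Omega_f by simp
    next
      case congested
      note l = Omega_cD[OF congested(1)]
      have "lax (mark M ul) v \<in> \<Delta>" if v: "vel ul \<le> v" "v \<le> vel ur" for v
      proof (rule \<Delta>I[OF w])
        show v0: "0 \<le> v" "v \<le> Vc M" using v l r by auto
        have "vel ur \<le> vel (u_f M (mark M ul))" "v \<le> vel (u_f M (Wmax M))"
          using vel_u_f(1)[OF w] vel_u_f(1)[OF marks_ends(2)] r(4) v0 by auto
        then show "flow (lax (mark M ul) v) \<le> Q0 M" "Q0 M \<le> flow (lax (Wmax M) v)"
          using flow_lax_mono[OF w v0(1) v(2)] flow flow_lax_mono[OF marks_ends(2) l(3) v(1)]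
            capacity[OF ul congested(1)] by auto
      qed
      then show ?thesis
        using R2_congested[OF congested] R_ARZ_states[OF congested(1,3), of x] ul ur um by auto
    next
      case congested_free
      then show ?thesis using ur by simp
    next
      case shock
      then show ?thesis using R2_shock[of ul ur x] ul ur by simp
    next
      case free_congested
      then show ?thesis using R2_free_congested[of ul ur x] ul ur um by simp
    qed
  qed
  \<comment> \<open>from a congested to a free state, the congested waves end at u_c (mark ul)\<close>
  have R2_cf: "R2 M ul ur x \<in> Omega_f M \<union> \<Delta>"
    if ul: "ul \<in> Omega_f M \<union> \<Delta>" "ul \<in> Omega_c M" and ur: "ur \<in> Omega_f M"
      and flow: "flow (u_c M (mark M ul)) \<le> Q0 M" for ul ur x
  proof -
    have w: "mark M ul \<in> marks" using Omega_cD(2)[OF ul(2)] .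
    have ur': "ur \<in> Omega_f M \<union> \<Delta>" using ur by simp
    show ?thesis
      using \<Omega>[OF ul(1)] \<Omega>[OF ur']
    proof (cases rule: Omega_cases)
      case free
      then show ?thesis using R2_free_in_Omega_f by simp
    next
      case congested
      then show ?thesis
        using R2[OF ul(1) ur'] Omega_c_free(2)[OF _ ur] flow by (simp add: u_c_lax)
    next
      case congested_free
      have uc: "u_c M (mark M ul) \<in> \<Delta>"
        using \<Delta>I[OF w, of "Vc M"] limits flow assms by (simp add: u_c_lax)
      then have "R2 M ul (u_c M (mark M ul)) x \<in> Omega_f M \<union> \<Delta>"
        using R2[OF ul(1), of "u_c M (mark M ul)"] u_c_in_Omega_c(1)[OF w] flow
        by (simp add: u_c_lax)
      then have "R_ARZ M ul (u_c M (mark M ul)) x \<in> Omega_f M \<union> \<Delta>"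
        using R2_congested[OF congested_free(1,2) u_c_in_Omega_c(1)[OF w]] by simp
      moreover have "R_LWR M (u_f M (mark M ul)) ur x \<in> Omega_f M"
        using lwr_states(1)[OF vel_u_f(3)[OF w] ur] .
      ultimately show ?thesis
        using R2_congested_free[OF congested_free, of x] by simp
    qed (use ur in auto)
  qed
  have "invariant_domain M (Omega_f M \<union> \<Delta>)"
  proof (rule invariant_domainI)
    fix ul ur x
    assume *: "ul \<in> Omega_f M \<union> \<Delta>" "ur \<in> Omega_f M \<union> \<Delta>" "(ul, ur) \<in> C2 M"
    have trace: "flow (trace_right (R2 M ul ur)) \<le> Q0 M"
      using *(3) by (simp add: C2_iff)
    have vr: "0 < vel ur" if "ur \<in> Omega_c M"
      using capacity[OF *(2) that] limits(3) Omega_cD(3)[OF that]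
      by (cases "vel ur = 0") (auto simp: flow_lax)
    show "R2 M ul ur x \<in> Omega_f M \<union> \<Delta>"
      using \<Omega>[OF *(1)] \<Omega>[OF *(2)]
    proof (cases rule: Omega_cases)
      case free
      then show ?thesis using R2_free_in_Omega_f by simp
    next
      case congested
      then show ?thesis
        using R2[OF *(1,2)] traces_congested(2)[OF congested] vr[OF congested(3)] trace by simp
    next
      case congested_free
      have "flow (u_c M (mark M ul)) \<le> Q0 M"
        using flow_u_f_ge[OF Omega_cD(2)[OF congested_free(1)]] trace_congested_free[OF congested_free]
          trace by simp
      then show ?thesis using R2_cf[OF *(1) congested_free(1,3)] by simp
    next
      case shock
      then show ?thesis using R2_shock[of ul ur x] * by simp
    next
      case free_congested
      note r = Omega_cD[OF free_congested(2)]
      have w: "mark M ul \<in> marks" using mark_Omega_f[OF free_congested(1)] .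
      \<comment> \<open>from a state of Omega_f'' the flow drops along the curve, so that the middle state is seen
        at 0; from a state of Omega_f' the middle state has mark Wc and carries no more than ur\<close>
      have "flow (lax (mark M ul) (vel ur)) \<le> Q0 M"
        using free_congested(1)
      proof (cases rule: Omega_f_cases)
        case 1
        have "flow (lax (mark M ul) (vel ur)) \<le> flow ur"
          using flow_lax_mono_mark[OF w r(2) _ r(3,4)] Omega_f'D(3)[OF 1] r(1,2) by simp
        also have "\<dots> \<le> Q0 M"
          using *(2) free_congested(3) by (simp add: \<Delta>_def)
        finally show ?thesis .
      next
        case 2
        have "vel ur \<le> vel (u_f M (mark M ul))"
          using vel_u_f(1)[OF w] r(4) by simp
        then have "flow (lax (mark M ul) (vel ur)) \<le> flow ul"
          using flow_lax_mono[OF w r(3) _ order_refl] lax_u_f[OF w] u_f_mark[OF 2] by simp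
        then show ?thesis
          using traces_free_congested(4)[of ul ur] free_congested vr trace by simp
      qed
      then show ?thesis using R2[OF *(1,2) free_congested(2)] by simp
    qed
  next
    fix ul ur a b x
    assume *: "ul \<in> Omega_f M \<union> \<Delta>" "ur \<in> Omega_f M \<union> \<Delta>" "(ul, ur) \<notin> C2 M"
      "constrained_pair M ul ur = (a, b)"
    have q: "min (Q0 M) (flow (u_c M (Wmax M))) = Q0 M" using assms by simp
    obtain a' b' where pair: "constrained_pair M ul ur = (a', b')" "a' \<in> Omega_c M" "b' \<in> Omega M"
      "flow a' = Q0 M" "flow b' = Q0 M" "mark M ul \<le> mark M a'"
      "ur \<notin> Omega_c M \<Longrightarrow> b' \<in> Omega_f M"
      "ur \<in> Omega_c M \<Longrightarrow> flow (lax (Wc M) (vel ur)) \<le> Q0 M \<Longrightarrow> b' \<in> Omega_c M \<and> vel b' = vel ur"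
      "ur \<in> Omega_c M \<Longrightarrow> Q0 M < flow (lax (Wc M) (vel ur)) \<Longrightarrow> b' \<in> Omega_f M"
      using constrained_pair_cases[OF \<Omega>[OF *(1)] \<Omega>[OF *(2)] *(3)] unfolding q by metis
    have [simp]: "a' = a" "b' = b" using pair(1) *(4) by auto
    note pair = pair[simplified]
    note A = Omega_cD[OF pair(2)]
    have a: "a \<in> \<Delta>" using of_flow_Q0 pair by simp
    have "flow (lax (mark M ul) (vel a)) \<le> Q0 M"
      using flow_lax_mono_mark[OF mark_Omega[OF \<Omega>[OF *(1)]] A(2) pair(6) A(3,4)] A(1) pair(4) by simp
    then show "a \<in> Omega_f M \<union> \<Delta> \<and> R2 M ul a x \<in> Omega_f M \<union> \<Delta>"
      using R2[OF *(1) _ pair(2)] a by simp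
    have b: "b \<in> Omega_f M \<union> \<Delta>"
      using pair(3,5) of_flow_Q0[of b] by (auto simp: Omega_def)
    show "R2 M b ur x \<in> Omega_f M \<union> \<Delta>"
    proof (cases "ur \<in> Omega_f M \<and> b \<in> Omega_f M")
      case True
      then show ?thesis using R2_free_in_Omega_f by simp
    next
      case False
      then have ur: "ur \<in> Omega_c M"
        using pair(7) *(2) by (auto simp: \<Delta>_def)
      note r = Omega_cD[OF ur]
      have "flow (lax (Wc M) (vel ur)) \<le> Q0 M"
      proof (rule ccontr)
        assume gt: "\<not> flow (lax (Wc M) (vel ur)) \<le> Q0 M"
        then have "b \<in> Omega_f M" using pair(9)[OF ur] by simp
        then have "flow ur \<le> Q0 M" using False *(2) by (simp add: \<Delta>_def)
        moreover have "flow (lax (Wc M) (vel ur)) \<le> flow ur"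
          using flow_lax_mono_mark[OF marks_ends(1) r(2) _ r(3,4)] r(1,2) by simp
        ultimately show False using gt by simp
      qed
      then have B: "b \<in> Omega_c M" "vel b = vel ur" using pair(8)[OF ur] by auto
      then have "lax (mark M b) (vel ur) = b" using Omega_cD(1)[OF B(1)] by simp
      then show ?thesis using R2[OF b *(2) ur] pair(5) by simp
    qed
  next
    fix ul ur x
    assume *: "ul \<in> Omega_f M \<union> \<Delta>" "ul \<in> Omega_c M" "flow (u_c M (mark M ul)) < Q0 M"
    then show "R2 M ul (u_f M (mark M ul)) x \<in> Omega_f M \<union> \<Delta>"
      using R2_cf[OF *(1,2) vel_u_f(3)[OF Omega_cD(2)[OF *(2)]]] by simp
  qed (use \<Omega> in blast)
  then show ?thesis by (simp only: D_eq)
qed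

end

theorem proposition3p6:
  fixes M :: traffic_data
  assumes "traffic_model M"
  shows
    "(Q0 M < flow (u_c M (Wmax M)) \<longrightarrow>
        invariant_domain M
          (Omega_f M \<union>
           {u \<in> Omega_c M. flow u \<le> Q0 M \<and> pinv M (Wmax M - vel u) * vel u \<ge> Q0 M})) \<and>
     (flow (u_c M (Wmax M)) \<le> Q0 M \<longrightarrow>
        invariant_domain M (Omega_f M \<union> {u_c M (Wmax M)})) \<and>
     (Q0 M \<ge> flow (u_c M (Wc M)) \<longrightarrow>
        invariant_domain M (Omega_c M)) \<and>
     (Q0 M < flow (u_c M (Wc M)) \<longrightarrow>
        invariant_domain M (Omega_c M \<union> {u \<in> Omega_f' M. flow u = Q0 M}))"
proof -
  interpret phase_transition M
    using assms by unfold_locales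
  show ?thesis
    using Omega_f_with_congested_states_invariant Omega_f_with_max_state_invariant
      Omega_c_invariant Omega_c_with_free_state_invariant by blast
qed

end
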